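(* Let $d$ be even and $q$ odd, and let $(Y,Z)$ be a cross-intersecting EKR set of generators of $W(2d-1,q)$ of maximum size. Then $Y=Z$.
   Context: All dimensions are vector space dimensions. $W(2d-1,q)$ is the symplectic polar space of rank $d$ in $\mathrm{PG}(2d-1,q)$, $q$ a prime power; generators are its totally isotropic subspaces of the maximal dimension $d$. A cross-intersecting EKR set of generators is a pair $(Y,Z)$ of sets of generators such that every $y\in Y$ and $z\in Z$ satisfy $\dim(y\cap z)\ge1$; it is of maximum size if $|Y|\cdot|Z|$ is maximum among all cross-intersecting EKR sets of the polar space. *)

theory Defs
  imports "HOL-Analysis.Cartesian_Space"
begin

definition bilinear_form :: "('a::field ^ 'n \<Rightarrow> 'a ^ 'n \<Rightarrow> 'a) \<Rightarrow> bool" where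
  "bilinear_form B \<longleftrightarrow>
     (\<forall>x. Vector_Spaces.linear (*s) (*) (\<lambda>y. B x y)) \<and>
     (\<forall>y. Vector_Spaces.linear (*s) (*) (\<lambda>x. B x y))"

definition symplectic_form :: "('a::field ^ 'n \<Rightarrow> 'a ^ 'n \<Rightarrow> 'a) \<Rightarrow> bool" where
  "symplectic_form B \<longleftrightarrow>
     bilinear_form B \<and> (\<forall>x. B x x = 0) \<and> (\<forall>x. (\<forall>y. B x y = 0) \<longrightarrow> x = 0)"

definition totally_isotropic ::
    "('a::field ^ 'n \<Rightarrow> 'a ^ 'n \<Rightarrow> 'a) \<Rightarrow> ('a ^ 'n) set \<Rightarrow> bool" where
  "totally_isotropic B U \<longleftrightarrow> vec.subspace U \<and> (\<forall>x\<in>U. \<forall>y\<in>U. B x y = 0)"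

text \<open>
  The polar space \<open>W(2d-1,q)\<close> is given by a symplectic form \<open>B\<close> on \<open>'a ^ 'n\<close>, where \<open>'a\<close> is
  the field with \<open>q\<close> elements and \<open>'n\<close> has \<open>2d\<close> elements. Subspaces are carrier sets of vectors,
  and dimensions are vector space dimensions (a point of the projective space has dimension 1).
\<close>

definition generators ::
    "nat \<Rightarrow> ('a::field ^ 'n \<Rightarrow> 'a ^ 'n \<Rightarrow> 'a) \<Rightarrow> ('a ^ 'n) set set" where
  "generators d B = {U. totally_isotropic B U \<and> vec.dim U = d}"

definition cross_intersecting_EKR ::
    "nat \<Rightarrow> ('a::field ^ 'n \<Rightarrow> 'a ^ 'n \<Rightarrow> 'a) \<Rightarrow>
     ('a ^ 'n) set set \<Rightarrow> ('a ^ 'n) set set \<Rightarrow> bool" where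
  "cross_intersecting_EKR d B Y Z \<longleftrightarrow>
     Y \<subseteq> generators d B \<and> Z \<subseteq> generators d B \<and>
     (\<forall>y\<in>Y. \<forall>z\<in>Z. vec.dim (y \<inter> z) \<ge> 1)"

text \<open>
  Cardinalities are only meaningful for a finite field, where every set of generators is finite.
\<close>

definition maximum_cross_intersecting_EKR ::
    "nat \<Rightarrow> ('a::{field,finite} ^ 'n \<Rightarrow> 'a ^ 'n \<Rightarrow> 'a) \<Rightarrow>
     ('a ^ 'n) set set \<Rightarrow> ('a ^ 'n) set set \<Rightarrow> bool" where
  "maximum_cross_intersecting_EKR d B Y Z \<longleftrightarrow>
     cross_intersecting_EKR d B Y Z \<and>
     (\<forall>Y' Z'. cross_intersecting_EKR d B Y' Z' \<longrightarrow> card Y' * card Z' \<le> card Y * card Z)"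

end

theory Submission
  imports Defs
begin

text \<open>
  The proof is spectral, with a geometric argument at the end that uses \<open>q\<close> odd.

  Consider the graph on the generators in which two of them are adjacent if they are disjoint. Its
  adjacency operator sends the indicator function of the pencil of a subspace \<open>J\<close> (the generators through
  \<open>J\<close>) to a multiple of the indicator function of the generators disjoint from \<open>J\<close>, and Moebius inversion
  turns the latter into a multiple of the pencil of \<open>J\<close> plus pencils of smaller subspaces
  (\<open>disjointness_pencil_mod_W\<close>). So the operator is triangular with respect to the filtration by the
  dimension of \<open>J\<close>, and being symmetric it is diagonalised by that filtration
  (\<open>eigen_decomposition\<close>). The constants have eigenvalue \<open>q ^ d * lam\<close>. On their orthogonal complement
  the eigenvalues are at most \<open>lam\<close> in absolute value, and for even \<open>d\<close> the value \<open>- lam\<close> occurs only in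
  the layer of points and the value \<open>lam\<close> only in the last layer.

  The Hoffman bound for cross-intersecting pairs limits \<open>|Y| |Z|\<close> to the square of the average size of a
  point pencil. As a point pencil of at least average size, paired with itself, is
  cross-intersecting, a maximum pair has equality (\<open>disjointness_maximum\<close>). Then the difference of
  the indicator functions of \<open>Y\<close> and \<open>Z\<close> lies in the last layer, and their sum is a sum of point
  weights (\<open>maximum_extremal_pair\<close>). In even rank the spectrum alone does not force \<open>Y = Z\<close>.

  Suppose that \<open>y\<close> is in \<open>Y\<close> but not in \<open>Z\<close>. The two conditions determine, for a subspace of \<open>y\<close> of
  codimension one or two, how many members of \<open>Y\<close> and of \<open>Z\<close> meet \<open>y\<close> exactly there: in every
  hyperplane one member of \<open>Z\<close> and none of \<open>Y\<close> (\<open>hyperplane_neighbours\<close>), and in no subspace of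
  codimension two a member of \<open>Z\<close> (\<open>no_codimension_2\<close>). Modulo a subspace \<open>R\<close> of codimension two in \<open>y\<close> this
  gives three pairwise disjoint totally isotropic lines of a four-dimensional symplectic space and
  three totally isotropic lines meeting all of them. Such lines correspond to isotropic points of a
  nondegenerate symmetric form on a line, of which there are at most two in odd characteristic: a
  contradiction (\<open>Y_subset_Z\<close>).
\<close>

section \<open>Linear algebra of a symplectic space over a finite field\<close>

text \<open>
The real number \<open>q\<close> is the size of the field; it is a real because all counts below are compared
with eigenvalues and inner products.
\<close>
locale symplectic_space =
  fixes B :: "'a::{field,finite} ^ 'n \<Rightarrow> 'a ^ 'n \<Rightarrow> 'a" and d :: nat and q :: real
  assumes CARD_field: "real CARD('a) = q" and symplectic: "symplectic_form B" and CARD_index: "CARD('n) = 2 * d"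
begin

abbreviation G :: "('a ^ 'n) set set" where "G \<equiv> generators d B"
definition perp :: "('a ^ 'n) set \<Rightarrow> ('a ^ 'n) set" where
  "perp S = {x. \<forall>s\<in>S. B s x = 0}"
abbreviation adjoin :: "'a ^ 'n \<Rightarrow> ('a ^ 'n) set \<Rightarrow> ('a ^ 'n) set" where
  "adjoin v J \<equiv> vec.span (insert v J)"

lemma linear_B: "Vector_Spaces.linear (*s) (*) (B x)" "Vector_Spaces.linear (*s) (*) (\<lambda>x. B x y)"
  using symplectic by (auto simp: symplectic_form_def bilinear_form_def)

lemma B_simps [simp]:
  "B (x + y) z = B x z + B y z" "B z (x + y) = B z x + B z y"
  "B (c *s x) z = c * B x z" "B z (c *s x) = c * B z x"
  "B 0 z = 0" "B z 0 = 0" "B x x = 0"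
  "B (x - y) z = B x z - B y z" "B z (x - y) = B z x - B z y"
proof -
  interpret r: Vector_Spaces.linear "(*s)" "(*)" "B z" for z by (rule linear_B)
  interpret l: Vector_Spaces.linear "(*s)" "(*)" "\<lambda>x. B x z" for z by (rule linear_B)
  show "B (x + y) z = B x z + B y z" "B z (x + y) = B z x + B z y"
  "B (c *s x) z = c * B x z" "B z (c *s x) = c * B z x"
  "B 0 z = 0" "B z 0 = 0"
  "B (x - y) z = B x z - B y z" "B z (x - y) = B z x - B z y"
    by (fact r.add l.add r.scale l.scale r.zero l.zero r.diff l.diff)+
  show "B x x = 0" using symplectic by (auto simp: symplectic_form_def)
qed

lemma B_skew: "B x y = - B y x"
proof -
  have "B (x + y) (x + y) = B x x + B x y + (B y x + B y y)"
    by (simp only: B_simps(1,2) add_ac)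
  then have "B x y + B y x = 0" by simp
  then show ?thesis by (simp add: eq_neg_iff_add_eq_0)
qed

lemma B_eq_0_commute: "B x y = 0 \<longleftrightarrow> B y x = 0"
  by (subst B_skew) simp

lemma nondegenerate: "(\<And>y. B x y = 0) \<Longrightarrow> x = 0"
  using symplectic by (auto simp: symplectic_form_def)

lemma d_pos: "d > 0"
  using CARD_index zero_less_card_finite[where 'a='n] by simp

lemma q_gt_1: "1 < q"
proof -
  have "card {0, 1 :: 'a} \<le> CARD('a)" by (rule card_mono) auto
  then show ?thesis using CARD_field by simp
qed

lemma subspace_perp [simp]: "vec.subspace (perp S)"
  by (auto simp: perp_def vec.subspace_def)

lemma perp_antimono: "S \<subseteq> T \<Longrightarrow> perp T \<subseteq> perp S"
  by (auto simp: perp_def)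

lemma perp_span [simp]: "perp (vec.span S) = perp S"
proof
  show "perp (vec.span S) \<subseteq> perp S" by (simp add: perp_antimono vec.span_superset)
  show "perp S \<subseteq> perp (vec.span S)"
  proof
    fix x assume "x \<in> perp S"
    then have "S \<subseteq> perp {x}" by (auto simp: perp_def B_eq_0_commute[of x])
    then have "vec.span S \<subseteq> perp {x}" by (simp add: vec.span_minimal)
    then show "x \<in> perp (vec.span S)" by (auto simp: perp_def B_eq_0_commute[of x])
  qed
qed

lemma perp_insert: "perp (insert v S) = perp S \<inter> perp {v}"
  by (auto simp: perp_def)

lemma dim_Int_perp_singleton: 
  assumes "vec.subspace X" shows "vec.dim X \<le> vec.dim (X \<inter> perp {v}) + 1"
proof (cases "X \<subseteq> perp {v}")
  case True
  then show ?thesis by (simp add: Int_absorb2)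
next
  case False
  then obtain e where e: "e \<in> X" "B v e \<noteq> 0" by (auto simp: perp_def)
  have "X \<subseteq> vec.span (insert e (X \<inter> perp {v}))"
  proof
    fix x assume x: "x \<in> X"
    let ?k = "B v x / B v e"
    have "x - ?k *s e \<in> X \<inter> perp {v}"
      using e x assms by (auto simp: perp_def intro!: vec.subspace_diff vec.subspace_scale)
    then show "x \<in> vec.span (insert e (X \<inter> perp {v}))"
      unfolding vec.span_breakdown_eq by (meson vec.span_base)
  qed
  then have "vec.dim X \<le> vec.dim (insert e (X \<inter> perp {v}))"
    by (metis vec.dim_span vec.dim_subset)
  also have "\<dots> \<le> vec.dim (X \<inter> perp {v}) + 1" by (simp add: vec.dim_insert)
  finally show ?thesis .
qed

lemma dim_Int_perp_finite:
  assumes "vec.subspace X" shows "vec.dim X \<le> vec.dim (X \<inter> perp A) + card A"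
proof -
  have "finite A" by simp
  then show ?thesis
  proof (induction A)
    case empty
    then show ?case by (simp add: perp_def)
  next
    case (insert v A)
    have "vec.dim (X \<inter> perp A) \<le> vec.dim ((X \<inter> perp A) \<inter> perp {v}) + 1"
      by (rule dim_Int_perp_singleton) (simp add: assms vec.subspace_inter)
    moreover have "X \<inter> perp (insert v A) = (X \<inter> perp A) \<inter> perp {v}"
      by (subst perp_insert) auto
    ultimately show ?case using insert by simp
  qed
qed

lemma perp_UNIV: "perp UNIV = {0}"
  using nondegenerate by (auto simp: perp_def) (metis B_eq_0_commute)

lemma dim_V: "vec.dim (UNIV :: ('a ^ 'n) set) = 2 * d"
  using CARD_index by (metis vec.dim_UNIV card_cart_basis)

text \<open>
Each vector cuts the dimension of a perp by at most one. Along a basis of the whole space the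
dimension falls from \<open>2 * d\<close> to \<open>0\<close> by nondegeneracy, so every basis vector must cut it by exactly one.
\<close>
lemma dim_perp:
  assumes "vec.subspace S" shows "vec.dim (perp S) + vec.dim S = 2 * d"
proof -
  obtain A where A: "A \<subseteq> S" "vec.independent A" "S \<subseteq> vec.span A" "card A = vec.dim S"
    using vec.basis_exists by metis
  obtain C where C: "A \<subseteq> C" "vec.independent C" "UNIV \<subseteq> vec.span C"
    using vec.maximal_independent_subset_extend[OF _ A(2)] by (metis subset_UNIV)
  have S: "S = vec.span A" using A assms by (simp add: subset_antisym vec.span_minimal)
  have "vec.dim (UNIV :: ('a ^ 'n) set) \<le> vec.dim (UNIV \<inter> perp A) + card A"
    by (rule dim_Int_perp_finite) simp
  then have 1: "2 * d \<le> vec.dim (perp S) + vec.dim S" using dim_V A(4) S by simp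
  have cC: "card C = 2 * d"
    using C dim_V vec.dim_eq_card_independent[OF C(2)] by (metis subset_antisym subset_UNIV vec.dim_span)
  have "vec.dim (perp A) \<le> vec.dim (perp A \<inter> perp (C - A)) + card (C - A)"
    by (rule dim_Int_perp_finite) simp
  also have "perp A \<inter> perp (C - A) = perp C" using C(1) by (auto simp: perp_def)
  also have "perp C = {0}" using C(3) perp_span[of C] perp_UNIV by (simp add: top.extremum_unique)
  finally have "vec.dim (perp S) \<le> card C - card A"
    using C(1) S by (simp add: card_Diff_subset)
  moreover have "card A \<le> card C" using C(1) by (simp add: card_mono)
  ultimately show ?thesis using 1 cC A(4) by linarith
qed

lemma card_subspace:
  fixes S :: "('a ^ 'n) set"
  assumes "vec.subspace S" shows "real (card S) = q ^ vec.dim S"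
proof -
  obtain A where A: "A \<subseteq> S" "vec.independent A" "S \<subseteq> vec.span A" "card A = vec.dim S"
    using vec.basis_exists by metis
  have S: "S = vec.span A" using A assms by (simp add: subset_antisym vec.span_minimal)
  have "finite A" by simp
  then have "vec.independent A \<Longrightarrow> card (vec.span A) = CARD('a) ^ card A"
  proof (induction A)
    case empty
    then show ?case by simp
  next
    case (insert v A)
    let ?f = "\<lambda>(k, x). k *s v + x"
    have v: "v \<notin> vec.span A" "vec.independent A" using insert by (auto simp: vec.independent_insert)
    have "inj_on ?f (UNIV \<times> vec.span A)"
    proof (rule inj_onI, clarify)
      fix k x l y assume xy: "x \<in> vec.span A" "y \<in> vec.span A" "k *s v + x = l *s v + y"
      have "k *s v = l *s v + y - x" using xy(3) by (simp add: eq_diff_eq)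
      then have "(k - l) *s v = y - x" by (simp add: vec.scale_left_diff_distrib)
      then have kl: "(k - l) *s v \<in> vec.span A" using xy by (simp add: vec.span_diff)
      have "k = l"
      proof (rule ccontr)
        assume "k \<noteq> l"
        then have "inverse (k - l) *s ((k - l) *s v) = v" by (simp add: vec.scale_scale)
        with kl v show False by (metis vec.span_scale)
      qed
      with xy show "k = l \<and> x = y" by simp
    qed
    moreover have "?f ` (UNIV \<times> vec.span A) = vec.span (insert v A)"
    proof (intro equalityI subsetI)
      fix x assume "x \<in> ?f ` (UNIV \<times> vec.span A)"
      then obtain k y where "x = k *s v + y" "y \<in> vec.span A" by auto
      then show "x \<in> vec.span (insert v A)" unfolding vec.span_breakdown_eq
        by (metis add_diff_cancel_left')
    next
      fix x assume "x \<in> vec.span (insert v A)"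
      then obtain k where "x - k *s v \<in> vec.span A" by (auto simp: vec.span_breakdown_eq)
      then have "?f (k, x - k *s v) \<in> ?f ` (UNIV \<times> vec.span A)" by blast
      then show "x \<in> ?f ` (UNIV \<times> vec.span A)" by simp
    qed
    ultimately have "card (vec.span (insert v A)) = CARD('a) * card (vec.span A)"
      by (metis card_cartesian_product card_image)
    with insert v show ?case by simp
  qed
  with A S CARD_field show ?thesis by simp
qed

lemma card_subspace_Diff:
  fixes S T :: "('a ^ 'n) set"
  assumes "vec.subspace S" "vec.subspace T" "T \<subseteq> S"
  shows "real (card (S - T)) = q ^ vec.dim S - q ^ vec.dim T"
  using assms by (simp add: card_Diff_subset card_mono of_nat_diff flip: card_subspace)

lemma totally_isotropic_iff: "totally_isotropic B U \<longleftrightarrow> vec.subspace U \<and> U \<subseteq> perp U"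
  by (auto simp: totally_isotropic_def perp_def)

lemma totally_isotropic_dim: "totally_isotropic B U \<Longrightarrow> vec.dim U \<le> d"
  using dim_perp[of U] vec.dim_subset[of U "perp U"] by (auto simp: totally_isotropic_iff)

lemma totally_isotropic_subset:
  "totally_isotropic B U \<Longrightarrow> vec.subspace T \<Longrightarrow> T \<subseteq> U \<Longrightarrow> totally_isotropic B T"
  by (auto simp: totally_isotropic_def)

lemma totally_isotropic_adjoin:
  assumes "totally_isotropic B J" "v \<in> perp J" shows "totally_isotropic B (adjoin v J)"
proof -
  have "insert v J \<subseteq> perp (insert v J)"
  proof
    fix x assume x: "x \<in> insert v J"
    have "B s x = 0" if s: "s \<in> insert v J" for s
    proof (cases "x = v")
      case True
      then show ?thesis using s assms(2) by (auto simp: perp_def)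
    next
      case False
      then show ?thesis using s x assms by (auto simp: perp_def totally_isotropic_def B_eq_0_commute[of v])
    qed
    then show "x \<in> perp (insert v J)" by (simp add: perp_def)
  qed
  then show ?thesis by (simp add: totally_isotropic_iff vec.span_minimal)
qed

lemma adjoin_superset: "J \<subseteq> adjoin v J" "v \<in> adjoin v J"
  using vec.span_superset by blast+

lemma adjoin_subset_iff: "vec.subspace U \<Longrightarrow> adjoin v J \<subseteq> U \<longleftrightarrow> v \<in> U \<and> J \<subseteq> U"
  by (metis insert_subset subset_trans vec.span_minimal vec.span_superset)

lemma dim_adjoin:
  assumes "vec.subspace J" "v \<notin> J" shows "vec.dim (adjoin v J) = Suc (vec.dim J)"
proof -
  have "v \<notin> vec.span J" using assms by (metis vec.span_eq_iff)
  then show ?thesis by (simp add: vec.dim_insert)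
qed

lemma adjoinE:
  assumes "vec.subspace J" "x \<in> adjoin v J"
  obtains k a where "a \<in> J" "x = k *s v + a"
proof -
  obtain k where "x - k *s v \<in> J" using assms by (metis vec.span_breakdown_eq vec.span_eq_iff)
  then show ?thesis by (intro that[of "x - k *s v" k]) auto
qed

text \<open>
A space reaching outside \<open>z\<close> by one dimension only keeps its trace on \<open>z\<close>: this turns conditions
on how a generator meets \<open>z\<close> into conditions on the subspaces it contains.
\<close>
lemma adjoin_Int:
  assumes z: "vec.subspace z" and J: "vec.subspace J" "J \<subseteq> z" and x: "x \<notin> z"
  shows "adjoin x J \<inter> z = J"
proof
  show "adjoin x J \<inter> z \<subseteq> J"
  proof
    fix y assume y: "y \<in> adjoin x J \<inter> z"
    then obtain k a where ka: "a \<in> J" "y = k *s x + a" using adjoinE[OF J(1)] by blast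
    have "k = 0"
    proof (rule ccontr)
      assume k: "k \<noteq> 0"
      have "y - a \<in> z" using y ka J by (intro vec.subspace_diff z) auto
      then have "inverse k *s (y - a) \<in> z" by (rule vec.subspace_scale[OF z])
      then show False using k ka x by (simp add: vec.scale_scale)
    qed
    then show "y \<in> J" using ka by simp
  qed
  show "J \<subseteq> adjoin x J \<inter> z" using J(2) adjoin_superset by auto
qed

lemma generatorD:
  assumes "U \<in> G"
  shows "vec.subspace U" "vec.dim U = d" "totally_isotropic B U" "perp U = U"
proof -
  show "vec.subspace U" "vec.dim U = d" "totally_isotropic B U" 
    using assms by (auto simp: generators_def totally_isotropic_def)
  then show "perp U = U" using dim_perp[of U]
    by (intro vec.subspace_dim_equal[symmetric]) (auto simp: totally_isotropic_iff)
qed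

section \<open>Counting generators with a prescribed intersection\<close>

text \<open>
The sum \<open>J + (z \<inter> perp J)\<close> is the projection of the generator \<open>z\<close> onto \<open>J\<close>; modulo \<open>J\<close> it is a
generator of the residual polar space. It is handled inside the original space, so that no quotient
spaces are needed.
\<close>
lemma dim_transversal:
  assumes J: "totally_isotropic B J" and z: "z \<in> G"
  shows "vec.dim {a + b |a b. a \<in> J \<and> b \<in> z \<inter> perp J} = d"
proof -
  note zD = generatorD[OF z]
  have sJ: "vec.subspace J" using J by (simp add: totally_isotropic_iff)
  have p: "perp {a + b |a b. a \<in> J \<and> b \<in> z} = z \<inter> perp J"
  proof -
    have "perp {a + b |a b. a \<in> J \<and> b \<in> z} = perp z \<inter> perp J"
    proof (intro equalityI subsetI)
      fix x assume x: "x \<in> perp {a + b |a b. a \<in> J \<and> b \<in> z}"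
      have "B a x = 0" if "a \<in> J" for a 
        using x that vec.subspace_0[OF zD(1)] unfolding perp_def by force
      moreover have "B b x = 0" if "b \<in> z" for b
        using x that vec.subspace_0[OF sJ] unfolding perp_def by force
      ultimately show "x \<in> perp z \<inter> perp J" by (auto simp: perp_def)
    qed (auto simp: perp_def)
    then show ?thesis using zD(4) by simp
  qed
  have "vec.dim {a + b |a b. a \<in> J \<and> b \<in> z} + vec.dim (J \<inter> z) = vec.dim J + d"
    using vec.dim_sums_Int[OF sJ zD(1)] zD(2) by simp
  moreover have "vec.dim (z \<inter> perp J) + vec.dim {a + b |a b. a \<in> J \<and> b \<in> z} = 2 * d"
    using dim_perp[OF vec.subspace_sums[OF sJ zD(1)]] p by simp
  moreover have "vec.dim {a + b |a b. a \<in> J \<and> b \<in> z \<inter> perp J} + vec.dim (J \<inter> z)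
     = vec.dim J + vec.dim (z \<inter> perp J)"
  proof -
    have "J \<inter> (z \<inter> perp J) = J \<inter> z" using J by (auto simp: totally_isotropic_iff)
    then show ?thesis
      using vec.dim_sums_Int[OF sJ vec.subspace_inter[OF zD(1) subspace_perp], of J] by simp
  qed
  ultimately show ?thesis by linarith
qed

lemma double_count:
  assumes "finite A" "finite S"
  shows "(\<Sum>U\<in>A. real (card {x\<in>S. P U x})) = (\<Sum>x\<in>S. real (card {U\<in>A. P U x}))"
proof -
  have "(\<Sum>U\<in>A. real (card {x\<in>S. P U x})) = (\<Sum>U\<in>A. \<Sum>x\<in>S. if P U x then 1 else 0)"
    using assms by (simp add: sum.If_cases Int_def)
  also have "\<dots> = (\<Sum>x\<in>S. \<Sum>U\<in>A. if P U x then 1 else 0)" by (rule sum.swap)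
  also have "\<dots> = (\<Sum>x\<in>S. real (card {U\<in>A. P U x}))"
    using assms by (simp add: sum.If_cases Int_def)
  finally show ?thesis .
qed

text \<open>
Modulo \<open>J\<close> this counts the generators of a polar space of rank \<open>d - dim J\<close> disjoint from a given
one, which are parametrised by symmetric matrices. The proof is an induction upwards through \<open>J\<close>: count
pairs of a generator \<open>U\<close> and a vector \<open>v\<close> of \<open>U\<close> outside \<open>J\<close>. The vectors that occur are those of \<open>perp J\<close>
outside the projection of \<open>z\<close>, and each of them extends \<open>J\<close> to an instance of the induction hypothesis.
\<close>
lemma card_generators_meeting_in:
  assumes "totally_isotropic B J" "z \<in> G"
  shows "real (card {U\<in>G. J \<subseteq> U \<and> U \<inter> z \<subseteq> J}) = q ^ (Suc (d - vec.dim J) choose 2)"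
  using assms
proof (induction "d - vec.dim J" arbitrary: J)
  case 0
  then have dJ: "vec.dim J = d" using totally_isotropic_dim[of J] by simp
  have "{U\<in>G. J \<subseteq> U \<and> U \<inter> z \<subseteq> J} = {J}"
  proof (intro equalityI subsetI)
    fix U assume U: "U \<in> {U\<in>G. J \<subseteq> U \<and> U \<inter> z \<subseteq> J}"
    then have "J = U" using 0 generatorD[of U] dJ
      by (intro vec.subspace_dim_equal) (auto simp: totally_isotropic_def)
    then show "U \<in> {J}" by simp
  qed (use 0 dJ in \<open>auto simp: generators_def\<close>)
  then show ?case using dJ by (simp add: numeral_2_eq_2)
next
  case (Suc m)
  define j where "j = vec.dim J"
  have j: "d = j + Suc m" using Suc(2) by (simp add: j_def)
  \<comment> \<open>The projection of \<open>z\<close> onto \<open>J\<close>: a vector of it cannot be added to \<open>J\<close> without enlarging the trace on \<open>z\<close>.\<close>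
  define M where "M = {a + b |a b. a \<in> J \<and> b \<in> z \<inter> perp J}"
  let ?A = "{U\<in>G. J \<subseteq> U \<and> U \<inter> z \<subseteq> J}"
  note zD = generatorD[OF Suc(4)]
  have sJ: "vec.subspace J" using Suc(3) by (simp add: totally_isotropic_iff)
  have sM: "vec.subspace M" unfolding M_def
    by (intro vec.subspace_sums sJ vec.subspace_inter zD subspace_perp)
  have dM: "vec.dim M = d" unfolding M_def by (rule dim_transversal) fact+
  have JM: "J \<subseteq> M" unfolding M_def using vec.subspace_0[OF zD(1)] vec.subspace_0[OF subspace_perp]
    by force
  have MJ: "M \<subseteq> perp J" unfolding M_def using Suc(3) subspace_perp[of J]
    by (auto simp: totally_isotropic_iff vec.subspace_add subset_iff)
  have step: "{U\<in>?A. v \<in> U - J} = (if v \<in> perp J - M then {U\<in>G. adjoin v J \<subseteq> U \<and> U \<inter> z \<subseteq> adjoin v J} else {})"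
    for v
  proof (cases "v \<in> perp J - M")
    case v: True
    have "adjoin v J \<inter> z \<subseteq> J"
    proof
      fix x assume x: "x \<in> adjoin v J \<inter> z"
      obtain k a where ka: "a \<in> J" "x = k *s v + a" using adjoinE[OF sJ] x by blast
      have "k = 0"
      proof (rule ccontr)
        assume k: "k \<noteq> 0"
        have "v = inverse k *s (x - a)" using k ka by (simp add: vec.scale_scale)
        then have "v = (- inverse k) *s a + inverse k *s x"
          by (simp add: vec.scale_right_diff_distrib)
        moreover have "(- inverse k) *s a \<in> J" using ka sJ by (intro vec.subspace_scale)
        moreover have "inverse k *s x \<in> z" using x zD by (intro vec.subspace_scale) auto
        moreover have "inverse k *s x \<in> perp J"
          using v ka JM MJ by (auto intro!: vec.subspace_scale vec.subspace_add)
        ultimately show False using v unfolding M_def by blast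
      qed
      then show "x \<in> J" using ka by simp
    qed
    moreover have "v \<notin> J" using v JM by auto
    moreover have "adjoin v J \<subseteq> U \<longleftrightarrow> v \<in> U \<and> J \<subseteq> U" if "U \<in> G" for U
      using adjoin_subset_iff[OF generatorD(1)[OF that]] .
    moreover have "J \<subseteq> adjoin v J" by (rule adjoin_superset)
    ultimately show ?thesis using v by auto
  next
    case v: False
    have "v \<notin> U - J" if U: "U \<in> ?A" for U
    proof
      assume vU: "v \<in> U - J"
      have "v \<in> perp J" using U vU generatorD[of U] by (auto simp: perp_def)
      with v have "v \<in> M" by simp
      then obtain a b where ab: "v = a + b" "a \<in> J" "b \<in> z" unfolding M_def by auto
      have "v - a \<in> U" using ab U vU generatorD(1)[of U] by (intro vec.subspace_diff) auto
      then have "b \<in> U" using ab by simp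
      then have "b \<in> J" using U ab by auto
      then show False using ab vU sJ vec.subspace_add by auto
    qed
    then show ?thesis using v by auto
  qed
  have cnt: "real (card {U\<in>G. adjoin v J \<subseteq> U \<and> U \<inter> z \<subseteq> adjoin v J}) = q ^ (Suc m choose 2)"
    if v: "v \<in> perp J - M" for v
  proof -
    have "vec.dim (adjoin v J) = Suc j" using v JM dim_adjoin[OF sJ, of v] by (auto simp: j_def)
    then have "m = d - vec.dim (adjoin v J)" using j by simp
    from Suc(1)[OF this totally_isotropic_adjoin[OF Suc(3)] Suc(4)] v \<open>m = _\<close>
    show ?thesis by simp
  qed
  have cnt': "real (card {U\<in>?A. v \<in> U - J}) = (if v \<in> perp J - M then q ^ (Suc m choose 2) else 0)" for v
  proof (cases "v \<in> perp J - M")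
    case True
    then show ?thesis unfolding step using cnt[OF True] by (simp only: if_True)
  next
    case False
    then show ?thesis unfolding step by (simp only: if_False card.empty of_nat_0)
  qed
  have "(\<Sum>U\<in>?A. real (card {v\<in>UNIV. v \<in> U - J})) = (\<Sum>v\<in>UNIV. real (card {U\<in>?A. v \<in> U - J}))"
    by (rule double_count) simp_all
  also have "\<dots> = (\<Sum>v\<in>UNIV. if v \<in> perp J - M then q ^ (Suc m choose 2) else 0)"
    by (intro sum.cong refl) (rule cnt')
  also have "\<dots> = real (card (perp J - M)) * q ^ (Suc m choose 2)"
    by (simp add: sum.If_cases del: Diff_iff)
  also have "(\<Sum>U\<in>?A. real (card {v\<in>UNIV. v \<in> U - J})) = (\<Sum>U\<in>?A. q ^ d - q ^ j)"
    using generatorD card_subspace_Diff[OF _ sJ] by (intro sum.cong refl) (simp add: j_def set_diff_eq)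
  also have "real (card (perp J - M)) = q ^ (2 * d - j) - q ^ d"
  proof -
    have "vec.dim (perp J) = 2 * d - j" using dim_perp[OF sJ] by (simp add: j_def)
    then show ?thesis using card_subspace_Diff[OF subspace_perp sM MJ] dM by simp
  qed
  also have "q ^ (2 * d - j) - q ^ d = q ^ Suc m * (q ^ d - q ^ j)"
  proof -
    have "2 * d - j = Suc m + d" "d = Suc m + j" using j by simp_all
    then have "q ^ (2 * d - j) = q ^ Suc m * q ^ d" "q ^ d = q ^ Suc m * q ^ j"
      by (metis power_add)+
    then show ?thesis by (metis right_diff_distrib)
  qed
  finally have "(q ^ d - q ^ j) * real (card ?A) = (q ^ d - q ^ j) * (q ^ (Suc m + (Suc m choose 2)))"
    by (simp add: power_add mult_ac)
  moreover have "q ^ d - q ^ j \<noteq> 0" using power_strict_increasing[of j d q] q_gt_1 j by simp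
  ultimately have "real (card ?A) = q ^ (Suc m + (Suc m choose 2))" by (simp only: mult_cancel_left) simp
  moreover have "Suc (Suc m) choose 2 = Suc m + (Suc m choose 2)" by (simp add: numeral_2_eq_2)
  ultimately show ?case using Suc(2) by simp
qed


section \<open>The triangular action of disjointness on pencils\<close>

text \<open>
Functions on sets of vectors are elements of a Euclidean space, which makes the inner product and
orthogonal decompositions available; functions on generators are those that vanish elsewhere.
\<close>
definition ind :: "('a ^ 'n) set set \<Rightarrow> real ^ (('a ^ 'n) set)" where
  "ind A = (\<chi> U. if U \<in> A then 1 else 0)"

abbreviation pencil :: "('a ^ 'n) set \<Rightarrow> real ^ (('a ^ 'n) set)" where
  "pencil K \<equiv> ind {U\<in>G. K \<subseteq> U}"

abbreviation trace :: "('a ^ 'n) set \<Rightarrow> ('a ^ 'n) set \<Rightarrow> real ^ (('a ^ 'n) set)" where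
  "trace J X \<equiv> ind {U\<in>G. U \<inter> J = X}"

text \<open>
The span of the pencils of subspaces of dimension less than \<open>j\<close>. The strict bound makes \<open>W 0\<close> the
zero space, so that the filtration has a trivial bottom; \<open>W (Suc d)\<close> is the space of all functions on
generators.
\<close>
definition W :: "nat \<Rightarrow> (real ^ (('a ^ 'n) set)) set" where
  "W j = span {pencil K |K. totally_isotropic B K \<and> vec.dim K < j}"

lemma ind_nth [simp]: "ind A $ U = (if U \<in> A then 1 else 0)"
  by (simp add: ind_def)

lemma inner_ind: "inner f (ind A) = (\<Sum>U\<in>A. f $ U)"
  by (simp add: inner_vec_def if_distrib sum.If_cases cong: if_cong)

lemma subspace_W: "subspace (W j)"
  by (simp add: W_def)

lemma W_mono: "i \<le> j \<Longrightarrow> W i \<subseteq> W j"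
  unfolding W_def by (intro span_mono) auto

lemma pencil_in_W: "totally_isotropic B K \<Longrightarrow> vec.dim K < j \<Longrightarrow> pencil K \<in> W j"
  unfolding W_def by (intro span_base) auto

lemma hyperplane_exists:
  fixes X J :: "('a ^ 'n) set"
  assumes "vec.subspace X" "vec.subspace J" "X \<subseteq> J" "X \<noteq> J"
  obtains L where "vec.subspace L" "X \<subseteq> L" "L \<subseteq> J" "vec.dim J = Suc (vec.dim L)"
proof -
  obtain A where A: "A \<subseteq> X" "vec.independent A" "X \<subseteq> vec.span A" "card A = vec.dim X"
    using vec.basis_exists by metis
  obtain C where C: "A \<subseteq> C" "C \<subseteq> J" "vec.independent C" "J \<subseteq> vec.span C"
    using vec.maximal_independent_subset_extend[OF subset_trans[OF A(1) assms(3)] A(2)] by metis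
  have J: "J = vec.span C" using C assms(2) by (simp add: subset_antisym vec.span_minimal)
  have X: "X = vec.span A" using A assms(1) by (simp add: subset_antisym vec.span_minimal)
  have "C \<noteq> A" using J X assms(4) by auto
  then obtain c where c: "c \<in> C" "c \<notin> A" using C(1) by auto
  let ?L = "vec.span (C - {c})"
  have ind: "vec.independent (C - {c})" using C(3) vec.independent_mono by blast
  have "vec.dim J = card C" "vec.dim ?L = card (C - {c})"
    using J C(3) ind vec.dim_span_eq_card_independent by auto
  moreover have "card C = Suc (card (C - {c}))" using c(1) by (metis card_Suc_Diff1 finite)
  moreover have "X \<subseteq> ?L" unfolding X using C(1) c by (intro vec.span_mono) auto
  moreover have "?L \<subseteq> J" unfolding J by (intro vec.span_mono) auto
  ultimately show ?thesis using that[of ?L] by simp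
qed

text \<open>
A generator meeting the hyperplane \<open>L\<close> of \<open>J\<close> exactly in \<open>X\<close> meets \<open>J\<close> either in \<open>X\<close> or in some
one-dimensional extension of \<open>X\<close> by a vector outside \<open>L\<close>. The sum over vectors counts each extension
once for every vector in it outside \<open>X\<close>, whence the denominator.
\<close>
lemma trace_hyperplane:
  fixes X J L :: "('a ^ 'n) set"
  assumes X: "vec.subspace X" "X \<subseteq> L" and L: "vec.subspace L" "L \<subseteq> J"
    and J: "vec.subspace J" "vec.dim J = Suc (vec.dim L)"
  shows "trace L X = trace J X
    + (1 / (q ^ Suc (vec.dim X) - q ^ vec.dim X)) *\<^sub>R (\<Sum>v\<in>J - L. trace J (adjoin v X))"
proof -
  define D where "D = q ^ Suc (vec.dim X) - q ^ vec.dim X"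
  have D: "D > 0" unfolding D_def using q_gt_1 by simp
  have JL: "J = adjoin v L" if v: "v \<in> J - L" for v
  proof (rule vec.subspace_dim_equal[symmetric])
    show "adjoin v L \<subseteq> J" using v L J by (simp add: vec.span_minimal)
    show "vec.dim J \<le> vec.dim (adjoin v L)" using v L J dim_adjoin[of L v] by simp
  qed (use J in auto)
  have "(if U \<in> G \<and> U \<inter> L = X then 1 else 0)
     = (if U \<in> G \<and> U \<inter> J = X then 1 else 0)
     + (1 / D) * (\<Sum>v\<in>J - L. if U \<in> G \<and> U \<inter> J = adjoin v X then 1 else 0)" (is "?l = ?r1 + _ * ?r2") for U
  proof (cases "U \<in> G \<and> U \<inter> L = X")
    case UL: True
    then have sU: "vec.subspace U" using generatorD by auto
    define Y where "Y = U \<inter> J"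
    have sY: "vec.subspace Y" unfolding Y_def using sU J by (intro vec.subspace_inter)
    have XY: "X \<subseteq> Y" "Y \<inter> L = X" using UL L X by (auto simp: Y_def)
    have eq: "Y = adjoin v X \<longleftrightarrow> v \<in> Y - X" if v: "v \<in> J - L" for v
    proof
      assume "Y = adjoin v X"
      then show "v \<in> Y - X" using v X adjoin_superset[where J = X and v = v] by auto
    next
      assume vY: "v \<in> Y - X"
      show "Y = adjoin v X"
      proof
        show "adjoin v X \<subseteq> Y" using vY XY sY by (simp add: vec.span_minimal)
        show "Y \<subseteq> adjoin v X"
        proof
          fix y assume y: "y \<in> Y"
          then have "y \<in> adjoin v L" using JL[OF v] by (auto simp: Y_def)
          then obtain k a where ka: "a \<in> L" "y = k *s v + a" using adjoinE[OF L(1)] by blast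
          have "a = y - k *s v" using ka by simp
          then have "a \<in> Y" using y vY sY by (auto intro!: vec.subspace_diff vec.subspace_scale)
          then have "a \<in> X" using XY ka by auto
          then show "y \<in> adjoin v X" using ka adjoin_superset[where J = X and v = v]
            by (auto intro!: vec.span_add vec.span_scale)
        qed
      qed
    qed
    have r2: "?r2 = real (card (Y - X))"
    proof -
      have "?r2 = (\<Sum>v\<in>J - L. if v \<in> Y - X then 1 else 0)"
        using UL eq by (intro sum.cong refl) (auto simp: Y_def)
      also have "\<dots> = real (card ((J - L) \<inter> (Y - X)))" by (simp add: sum.If_cases del: Diff_iff)
      also have "(J - L) \<inter> (Y - X) = Y - X" using XY by (auto simp: Y_def)
      finally show ?thesis .
    qed
    show ?thesis
    proof (cases "Y = X")
      case True
      then show ?thesis using UL r2 by (simp add: Y_def)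
    next
      case False
      then obtain w where w: "w \<in> Y - X" using XY by auto
      then have "w \<in> J - L" using XY by (auto simp: Y_def)
      then have "Y = adjoin w X" using eq w by simp
      then have "vec.dim Y = Suc (vec.dim X)" using dim_adjoin X w by simp
      then have "?r2 = D" using r2 card_subspace_Diff[OF sY X(1) XY(1)] by (simp add: D_def)
      moreover have "?r1 = 0" using False by (auto simp: Y_def)
      ultimately show ?thesis using UL D by simp
    qed
  next
    case UL: False
    have "?r1 = 0" using UL L X by auto
    moreover have "\<not> (U \<in> G \<and> U \<inter> J = adjoin v X)" if v: "v \<in> J - L" for v
    proof
      assume U: "U \<in> G \<and> U \<inter> J = adjoin v X"
      have "adjoin v X \<inter> L = X" using v by (intro adjoin_Int L X) auto
      then have "U \<inter> L = X" using U L X adjoin_superset[where J = X and v = v] by blast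
      then show False using U UL by simp
    qed
    ultimately show ?thesis using UL by (simp add: sum.neutral)
  qed
  then show ?thesis by (simp add: vec_eq_iff D_def)
qed

text \<open>
This is Moebius inversion in the lattice of subspaces of \<open>J\<close>, up to pencils of smaller subspaces. Only
the leading coefficient matters. It satisfies a recursion in the codimension \<open>t\<close> of \<open>X\<close>: by
\<open>trace_hyperplane\<close> the function \<open>trace J X\<close> is, up to lower terms, minus the sum of \<open>q ^ t\<close> traces on
spaces of codimension \<open>t\<close> when \<open>X\<close> has codimension \<open>t + 1\<close>, because the trace on \<open>L\<close> involves no
pencil of \<open>J\<close>.
\<close>
lemma trace_mod_W:
  assumes "totally_isotropic B J" "vec.subspace X" "X \<subseteq> J"
  shows "trace J X - ((-1) ^ (vec.dim J - vec.dim X) * q ^ ((vec.dim J - vec.dim X) choose 2)) *\<^sub>R pencil J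
     \<in> W (vec.dim J)"
  using assms
proof (induction "vec.dim J - vec.dim X" arbitrary: J X)
  case 0
  then have "X = J"
    by (intro vec.subspace_dim_equal) (auto simp: totally_isotropic_def)
  moreover have "{U\<in>G. U \<inter> J = J} = {U\<in>G. J \<subseteq> U}" by auto
  ultimately show ?case using subspace_0[OF subspace_W] by (simp add: numeral_2_eq_2)
next
  case (Suc t)
  have sJ: "vec.subspace J" using Suc by (auto simp: totally_isotropic_def)
  have "X \<noteq> J" using Suc by auto
  then obtain L where L: "vec.subspace L" "X \<subseteq> L" "L \<subseteq> J" "vec.dim J = Suc (vec.dim L)"
    using hyperplane_exists[OF Suc(4) sJ Suc(5)] by metis
  have TL: "totally_isotropic B L" using totally_isotropic_subset Suc L by blast
  define x where "x = vec.dim X"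
  define D where "D = q ^ Suc x - q ^ x"
  have D: "D > 0" unfolding D_def using q_gt_1 by simp
  define m where "m t = (-1) ^ t * q ^ (t choose 2)" for t :: nat
  have dJ: "vec.dim J = x + Suc t" using Suc(2) by (simp add: x_def)
  have dL: "vec.dim L = x + t" using dJ L by simp
  have mS: "m (Suc t) = - (q ^ t) * m t"
    by (simp add: m_def numeral_2_eq_2 power_add)
  have "trace L X - m t *\<^sub>R pencil L \<in> W (vec.dim L)"
    using Suc(1)[of L X] TL Suc(4) L dL by (simp add: m_def x_def)
  then have 1: "trace L X \<in> W (vec.dim J)"
  proof -
    assume "trace L X - m t *\<^sub>R pencil L \<in> W (vec.dim L)"
    then have "trace L X - m t *\<^sub>R pencil L \<in> W (vec.dim J)" using W_mono[of "vec.dim L" "vec.dim J"] L by auto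
    moreover have "m t *\<^sub>R pencil L \<in> W (vec.dim J)"
      using L TL by (intro subspace_scale subspace_W pencil_in_W) auto
    ultimately have "(trace L X - m t *\<^sub>R pencil L) + m t *\<^sub>R pencil L \<in> W (vec.dim J)"
      by (rule subspace_add[OF subspace_W])
    then show ?thesis by simp
  qed
  have "trace J (adjoin v X) - m t *\<^sub>R pencil J \<in> W (vec.dim J)" if v: "v \<in> J - L" for v
  proof -
    have "vec.dim (adjoin v X) = Suc x" using v L dim_adjoin[of X v] Suc(4) by (auto simp: x_def)
    moreover have "adjoin v X \<subseteq> J" using v L sJ by (auto simp: vec.span_minimal)
    ultimately show ?thesis using Suc(1)[of J "adjoin v X"] dJ Suc(3) by (simp add: m_def)
  qed
  then have 2: "(1 / D) *\<^sub>R (\<Sum>v\<in>J - L. trace J (adjoin v X) - m t *\<^sub>R pencil J) \<in> W (vec.dim J)"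
    by (intro subspace_scale subspace_sum subspace_W)
  have card: "real (card (J - L)) = q ^ t * D"
    using card_subspace_Diff[OF sJ L(1,3)] dJ dL by (simp add: D_def power_add algebra_simps)
  have "trace J X - m (Suc t) *\<^sub>R pencil J
      = trace L X - (1 / D) *\<^sub>R (\<Sum>v\<in>J - L. trace J (adjoin v X) - m t *\<^sub>R pencil J)"
  proof -
    have "(1 / D) *\<^sub>R (\<Sum>v\<in>J - L. trace J (adjoin v X) - m t *\<^sub>R pencil J)
      = (1 / D) *\<^sub>R (\<Sum>v\<in>J - L. trace J (adjoin v X)) - ((1 / D) * real (card (J - L)) * m t) *\<^sub>R pencil J"
      by (simp add: sum_subtractf sum_constant_scaleR scaleR_diff_right mult.assoc del: sum_constant)
    moreover have "(1 / D) * real (card (J - L)) * m t = - m (Suc t)"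
      unfolding card mS using D by simp
    moreover have "trace L X = trace J X + (1 / D) *\<^sub>R (\<Sum>v\<in>J - L. trace J (adjoin v X))"
      using trace_hyperplane[of X L J] Suc(4) L sJ by (simp add: D_def x_def)
    ultimately show ?thesis by simp
  qed
  also have "\<dots> \<in> W (vec.dim J)" by (rule subspace_diff[OF subspace_W 1 2])
  finally show ?case using Suc(2) by (simp add: m_def)
qed

definition disjointness :: "real ^ (('a ^ 'n) set) \<Rightarrow> real ^ (('a ^ 'n) set)" where
  "disjointness f = (\<chi> z. if z \<in> G then \<Sum>y\<in>{y\<in>G. y \<inter> z = {0}}. f $ y else 0)"

text \<open>
The eigenvalues of the disjointness graph of the generators. The eigenvalue of the constants is
\<open>\<theta> 0 = q ^ d * lam\<close>, and \<open>lam\<close> is the largest absolute value among the others, attained with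
opposite signs at \<open>j = 1\<close> and, for even \<open>d\<close>, at \<open>j = d\<close>.
\<close>
definition \<theta> :: "nat \<Rightarrow> real" where
  "\<theta> j = (-1) ^ j * q ^ ((j choose 2) + (Suc (d - j) choose 2))"

definition lam :: real where "lam = q ^ (d choose 2)"

lemma linear_disjointness: "linear disjointness"
  by (rule linearI) (auto simp: disjointness_def vec_eq_iff sum.distrib sum_distrib_left)

lemma disjointness_symmetric: "inner (disjointness f) g = inner f (disjointness g)"
proof -
  let ?r = "\<lambda>y z. y \<in> G \<and> z \<in> G \<and> y \<inter> z = {0}"
  have *: "(disjointness f) $ z = (\<Sum>y\<in>UNIV. if ?r y z then f $ y else 0)" for f z
    by (simp add: disjointness_def sum.If_cases Collect_conj_eq Int_ac)
  have "inner (disjointness f) g = (\<Sum>z\<in>UNIV. \<Sum>y\<in>UNIV. if ?r y z then f $ y * g $ z else 0)"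
    unfolding inner_vec_def inner_real_def * sum_distrib_right by (intro sum.cong refl) auto
  also have "\<dots> = (\<Sum>y\<in>UNIV. \<Sum>z\<in>UNIV. if ?r y z then f $ y * g $ z else 0)"
    by (rule sum.swap)
  also have "\<dots> = inner f (disjointness g)"
    unfolding inner_vec_def inner_real_def * sum_distrib_left
    by (intro sum.cong refl) (auto simp: Int_commute)
  finally show ?thesis .
qed

text \<open>
A generator on \<open>J\<close> can avoid \<open>z\<close> only if \<open>J\<close> does, and then their number is known and depends
only on the dimension of \<open>J\<close>.
\<close>
lemma disjointness_pencil:
  assumes J: "totally_isotropic B J"
  shows "disjointness (pencil J) = q ^ (Suc (d - vec.dim J) choose 2) *\<^sub>R trace J {0}"
proof -
  have "(\<Sum>y\<in>{y\<in>G. y \<inter> z = {0}}. if y \<in> G \<and> J \<subseteq> y then 1 else 0)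
     = (if z \<inter> J = {0} then q ^ (Suc (d - vec.dim J) choose 2) else 0)" if z: "z \<in> G" for z
  proof -
    have 0: "0 \<in> J" "0 \<in> z" using J generatorD(1)[OF z] by (auto simp: totally_isotropic_def vec.subspace_0)
    have "(\<Sum>y\<in>{y\<in>G. y \<inter> z = {0}}. if y \<in> G \<and> J \<subseteq> y then 1 else 0)
      = real (card {y\<in>G. J \<subseteq> y \<and> y \<inter> z = {0}})"
      by (simp add: sum.If_cases) (rule arg_cong[where f = card], auto)
    also have "{y\<in>G. J \<subseteq> y \<and> y \<inter> z = {0}} = (if z \<inter> J = {0} then {y\<in>G. J \<subseteq> y \<and> y \<inter> z \<subseteq> J} else {})"
      using 0 by auto
    finally show ?thesis using card_generators_meeting_in[OF J z] by simp
  qed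
  then show ?thesis by (simp add: vec_eq_iff disjointness_def)
qed

lemma disjointness_pencil_mod_W:
  assumes J: "totally_isotropic B J"
  shows "disjointness (pencil J) - \<theta> (vec.dim J) *\<^sub>R pencil J \<in> W (vec.dim J)"
proof -
  have "vec.subspace {0 :: 'a ^ 'n}" "{0} \<subseteq> J"
    using J by (auto simp: totally_isotropic_def vec.subspace_0 vec.subspace_single_0)
  from trace_mod_W[OF J this] have "q ^ (Suc (d - vec.dim J) choose 2) *\<^sub>R
      (trace J {0} - ((-1) ^ vec.dim J * q ^ (vec.dim J choose 2)) *\<^sub>R pencil J) \<in> W (vec.dim J)"
    by (intro subspace_scale subspace_W) simp
  then show ?thesis unfolding disjointness_pencil[OF J]
    by (simp add: \<theta>_def scaleR_diff_right power_add mult_ac)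
qed

lemma disjointness_triangular:
  assumes "f \<in> W (Suc j)" shows "disjointness f - \<theta> j *\<^sub>R f \<in> W j"
proof -
  let ?T = "{f. disjointness f - \<theta> j *\<^sub>R f \<in> W j}"
  have eq: "?T = (\<lambda>f. disjointness f - \<theta> j *\<^sub>R f) -` W j" by auto
  have "linear (\<lambda>f. disjointness f - \<theta> j *\<^sub>R f)"
    by (intro linear_compose_sub linear_disjointness linear_scaleR)
  then have sub: "subspace ?T" unfolding eq by (rule linear_subspace_vimage[OF _ subspace_W])
  have "pencil K \<in> ?T" if K: "totally_isotropic B K" "vec.dim K < Suc j" for K
  proof (cases "vec.dim K = j")
    case True
    then show ?thesis using disjointness_pencil_mod_W[OF K(1)] by simp
  next
    case False
    then have Kj: "vec.dim K < j" using K by simp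
    have "disjointness (pencil K) - \<theta> (vec.dim K) *\<^sub>R pencil K \<in> W j"
      using disjointness_pencil_mod_W[OF K(1)] W_mono[of "vec.dim K" j] Kj by auto
    moreover have "(\<theta> (vec.dim K) - \<theta> j) *\<^sub>R pencil K \<in> W j"
      by (intro subspace_scale subspace_W pencil_in_W K Kj)
    ultimately have "(disjointness (pencil K) - \<theta> (vec.dim K) *\<^sub>R pencil K) + (\<theta> (vec.dim K) - \<theta> j) *\<^sub>R pencil K \<in> W j"
      by (rule subspace_add[OF subspace_W])
    then show ?thesis by (simp add: scaleR_diff_left)
  qed
  then have "W (Suc j) \<subseteq> ?T" unfolding W_def[of "Suc j"] by (intro span_minimal sub) auto
  then show ?thesis using assms by auto
qed

lemma disjointness_W:
  assumes "f \<in> W j" shows "disjointness f \<in> W j"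
proof (cases j)
  case 0
  then have "f = 0" using assms by (simp add: W_def)
  then show ?thesis using subspace_0[OF subspace_W] by (simp add: linear_0[OF linear_disjointness])
next
  case (Suc i)
  then have "disjointness f - \<theta> i *\<^sub>R f \<in> W j"
    using disjointness_triangular[of f i] assms W_mono[of i j] by auto
  then have "(disjointness f - \<theta> i *\<^sub>R f) + \<theta> i *\<^sub>R f \<in> W j"
    using assms by (intro subspace_add subspace_scale subspace_W)
  then show ?thesis by simp
qed

section \<open>The spectrum of the disjointness graph\<close>

text \<open>
Disjointness is symmetric and respects the filtration \<open>W\<close>, acting on the \<open>j\<close>-th layer as \<open>\<theta> j\<close>.
Hence the part of \<open>W (Suc j)\<close> orthogonal to \<open>W j\<close> is invariant, and there the error term
\<open>disjointness b - \<theta> j *\<^sub>R b\<close> lies both in \<open>W j\<close> and in its orthogonal complement.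
\<close>
lemma eigen_decomposition:
  assumes "f \<in> W n"
  obtains e where "f = (\<Sum>i<n. e i)" "\<And>i. i < n \<Longrightarrow> e i \<in> W (Suc i)"
    "\<And>i g. i < n \<Longrightarrow> g \<in> W i \<Longrightarrow> inner (e i) g = 0"
    "\<And>i. i < n \<Longrightarrow> disjointness (e i) = \<theta> i *\<^sub>R e i"
  using assms
proof (induction n arbitrary: f thesis)
  case 0
  then show ?case by (simp add: W_def)
next
  case (Suc n)
  obtain a b where ab: "a \<in> span (W n)" "\<And>w. w \<in> span (W n) \<Longrightarrow> orthogonal b w" "f = a + b"
    using orthogonal_subspace_decomp_exists[of "W n" f] by metis
  have a: "a \<in> W n" using ab(1) subspace_W span_eq_iff by blast
  have orth: "inner b g = 0" if "g \<in> W n" for g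
    using ab(2) span_base[OF that] by (simp add: orthogonal_def)
  have b: "b \<in> W (Suc n)"
  proof -
    have "f - a \<in> W (Suc n)" using Suc(3) a W_mono[of n "Suc n"]
      by (intro subspace_diff subspace_W) auto
    then show ?thesis using ab(3) by simp
  qed
  define r where "r = disjointness b - \<theta> n *\<^sub>R b"
  have "r \<in> W n" unfolding r_def by (rule disjointness_triangular[OF b])
  moreover have "inner r g = 0" if "g \<in> W n" for g
    using orth[OF that] orth[OF disjointness_W[OF that]]
    by (simp add: r_def inner_diff_left disjointness_symmetric)
  ultimately have "r = 0" by (metis inner_eq_zero_iff)
  obtain e where e: "a = (\<Sum>i<n. e i)" "\<And>i. i < n \<Longrightarrow> e i \<in> W (Suc i)"
    "\<And>i g. i < n \<Longrightarrow> g \<in> W i \<Longrightarrow> inner (e i) g = 0"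
    "\<And>i. i < n \<Longrightarrow> disjointness (e i) = \<theta> i *\<^sub>R e i"
    using Suc(1)[OF _ a] by metis
  show ?case
  proof (rule Suc(2)[of "e(n := b)"])
    show "f = (\<Sum>i<Suc n. (e(n := b)) i)" using ab(3) e(1) by simp
  qed (use e b orth \<open>r = 0\<close> in \<open>auto simp: less_Suc_eq r_def\<close>)
qed

lemma eigen_components:
  assumes "f \<in> W (Suc d)"
  obtains e where "f = (\<Sum>i\<le>d. e i)" "\<And>i. i \<le> d \<Longrightarrow> e i \<in> W (Suc i)"
    "\<And>i g. i \<le> d \<Longrightarrow> g \<in> W i \<Longrightarrow> inner (e i) g = 0"
    "\<And>i. i \<le> d \<Longrightarrow> disjointness (e i) = \<theta> i *\<^sub>R e i"
    "\<And>i j. i \<le> d \<Longrightarrow> j \<le> d \<Longrightarrow> i \<noteq> j \<Longrightarrow> inner (e i) (e j) = 0"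
proof -
  obtain e where e: "f = (\<Sum>i<Suc d. e i)" "\<And>i. i < Suc d \<Longrightarrow> e i \<in> W (Suc i)"
    "\<And>i g. i < Suc d \<Longrightarrow> g \<in> W i \<Longrightarrow> inner (e i) g = 0"
    "\<And>i. i < Suc d \<Longrightarrow> disjointness (e i) = \<theta> i *\<^sub>R e i"
    using eigen_decomposition[OF assms] by metis
  have 1: "inner (e i) (e j) = 0" if "i < j" "j < Suc d" for i j
  proof -
    have "e i \<in> W j" using e(2)[of i] W_mono[of "Suc i" j] that by auto
    then show ?thesis using e(3)[of j "e i"] that by (simp add: inner_commute)
  qed
  have "inner (e i) (e j) = 0" if "i \<le> d" "j \<le> d" "i \<noteq> j" for i j
    using 1[of i j] 1[of j i] that by (cases "i < j") (auto simp: inner_commute)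
  with e show ?thesis by (intro that[of e]) (auto simp: lessThan_Suc_atMost)
qed

lemma inner_orthogonal_sum:
  fixes e :: "nat \<Rightarrow> 'b::real_inner"
  assumes "\<And>i j. i \<le> n \<Longrightarrow> j \<le> n \<Longrightarrow> i \<noteq> j \<Longrightarrow> inner (e i) (e j) = 0" "j \<le> n"
  shows "inner (\<Sum>i\<le>n. a i *\<^sub>R e i) (e j) = a j * inner (e j) (e j)"
proof -
  have "inner (\<Sum>i\<le>n. a i *\<^sub>R e i) (e j) = (\<Sum>i\<le>n. if i = j then a j * inner (e j) (e j) else 0)"
    unfolding inner_sum_left using assms by (intro sum.cong) auto
  then show ?thesis using assms(2) by simp
qed

text \<open>
The exponent of \<open>\<theta> j\<close> falls short of that of \<open>lam\<close> by \<open>(d - j) * (j - 1)\<close>, which shows at which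
indices the largest absolute value is reached.
\<close>
lemma choose_2_split: 
  assumes "1 \<le> j" "j \<le> d"
  shows "d choose 2 = ((j choose 2) + (Suc (d - j) choose 2)) + (d - j) * (j - 1)"
proof -
  have add: "(a + b) choose 2 = (a choose 2) + (b choose 2) + a * b" for a b :: nat
    by (induction a) (simp_all add: numeral_2_eq_2)
  obtain m i where "d = j + m" "j = Suc i" using assms by (metis le_Suc_ex Suc_le_D One_nat_def)
  then show ?thesis using add[of j m] by (simp add: numeral_2_eq_2)
qed

lemma lam_pos: "lam > 0"
  using q_gt_1 by (simp add: lam_def)

lemma theta_0: "\<theta> 0 = q ^ d * lam"
  by (simp add: \<theta>_def lam_def numeral_2_eq_2 power_add)

lemma abs_theta_le: 
  assumes "1 \<le> j" "j \<le> d" shows "\<bar>\<theta> j\<bar> \<le> lam"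
  using q_gt_1 choose_2_split[OF assms]
  by (auto simp: \<theta>_def lam_def abs_mult power_abs intro!: power_increasing)

lemma abs_theta_eqD:
  assumes "\<bar>\<theta> j\<bar> = lam" "j \<le> d" shows "j = 1 \<or> j = d"
proof (cases "j = 0")
  case True
  then show ?thesis using assms theta_0 q_gt_1 d_pos lam_pos one_less_power[of q d] by auto
next
  case False
  then have "(j choose 2) + (Suc (d - j) choose 2) = d choose 2"
    using assms q_gt_1 power_inject_exp[of q] by (auto simp: \<theta>_def lam_def abs_mult power_abs)
  then show ?thesis using choose_2_split[of j] False assms by auto
qed

lemma theta_1: "\<theta> 1 = - lam"
  using d_pos by (simp add: \<theta>_def lam_def numeral_2_eq_2)

lemma theta_d: "\<theta> d = (-1) ^ d * lam"
  by (simp add: \<theta>_def lam_def numeral_2_eq_2)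

lemma spectral_bound:
  assumes "f \<in> W (Suc d)" "inner f (pencil {0}) = 0"
  shows "inner (disjointness f) (disjointness f) \<le> lam\<^sup>2 * inner f f"
proof -
  obtain e where e: "f = (\<Sum>i\<le>d. e i)" "\<And>i. i \<le> d \<Longrightarrow> e i \<in> W (Suc i)"
    "\<And>i. i \<le> d \<Longrightarrow> disjointness (e i) = \<theta> i *\<^sub>R e i"
    "\<And>i j. i \<le> d \<Longrightarrow> j \<le> d \<Longrightarrow> i \<noteq> j \<Longrightarrow> inner (e i) (e j) = 0"
    using eigen_components[OF assms(1)] by metis
  have inn: "inner (\<Sum>i\<le>d. a i *\<^sub>R e i) (\<Sum>i\<le>d. b i *\<^sub>R e i) = (\<Sum>i\<le>d. a i * b i * inner (e i) (e i))" for a b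
    unfolding inner_sum_right using inner_orthogonal_sum[of d e _ a] e(4)
    by (intro sum.cong) (auto simp: mult_ac)
  have f: "f = (\<Sum>i\<le>d. 1 *\<^sub>R e i)" using e(1) by simp
  have Df: "disjointness f = (\<Sum>i\<le>d. \<theta> i *\<^sub>R e i)"
    using e(1,3) by (simp add: linear_sum[OF linear_disjointness])
  have e0: "inner (e 0) (e 0) = 0"
  proof -
    have "inner f (pencil K) = 0" if "totally_isotropic B K" "vec.dim K < 1" for K
    proof -
      have "K \<subseteq> {0}" "0 \<in> K"
        using that vec.dim_eq_0[of K] by (auto simp: totally_isotropic_def vec.subspace_0)
      then have "K = {0}" by auto
      then show ?thesis using assms(2) by simp
    qed
    then have "W 1 \<subseteq> {g. inner f g = 0}" unfolding W_def
      by (intro span_minimal subspace_hyperplane) auto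
    then have "inner f (e 0) = 0" using e(2)[of 0] by auto
    then show ?thesis using inner_orthogonal_sum[of d e 0 "\<lambda>_. 1"] e(4) f by auto
  qed
  have "inner (disjointness f) (disjointness f) = (\<Sum>i\<le>d. \<theta> i * \<theta> i * inner (e i) (e i))"
    unfolding Df by (rule inn)
  also have "\<dots> \<le> (\<Sum>i\<le>d. lam\<^sup>2 * inner (e i) (e i))"
  proof (intro sum_mono)
    fix i assume i: "i \<in> {..d}"
    show "\<theta> i * \<theta> i * inner (e i) (e i) \<le> lam\<^sup>2 * inner (e i) (e i)"
    proof (cases "i = 0")
      case False
      then have "\<theta> i * \<theta> i \<le> lam\<^sup>2"
        using abs_theta_le[of i] i lam_pos abs_le_square_iff[of "\<theta> i" lam] by (simp add: power2_eq_square)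
      then show ?thesis by (intro mult_right_mono) auto
    qed (use e0 in simp)
  qed
  also have "\<dots> = lam\<^sup>2 * inner f f"
    unfolding f inn by (simp add: sum_distrib_left)
  finally show ?thesis .
qed

text \<open>
An eigenvector lives in a single layer of the filtration as soon as its eigenvalue belongs to one
index only.
\<close>
lemma eigenvector_component:
  assumes "f \<in> W (Suc d)" "disjointness f = \<mu> *\<^sub>R f" "\<And>i. i \<le> d \<Longrightarrow> \<theta> i = \<mu> \<Longrightarrow> i = j" "j \<le> d"
  shows "f \<in> W (Suc j)" "\<And>g. g \<in> W j \<Longrightarrow> inner f g = 0"
proof -
  obtain e where e: "f = (\<Sum>i\<le>d. e i)" "\<And>i. i \<le> d \<Longrightarrow> e i \<in> W (Suc i)"
    "\<And>i g. i \<le> d \<Longrightarrow> g \<in> W i \<Longrightarrow> inner (e i) g = 0"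
    "\<And>i. i \<le> d \<Longrightarrow> disjointness (e i) = \<theta> i *\<^sub>R e i"
    "\<And>i j. i \<le> d \<Longrightarrow> j \<le> d \<Longrightarrow> i \<noteq> j \<Longrightarrow> inner (e i) (e j) = 0"
    using eigen_components[OF assms(1)] by metis
  have Df: "disjointness f = (\<Sum>i\<le>d. \<theta> i *\<^sub>R e i)"
    using e(1,4) by (simp add: linear_sum[OF linear_disjointness])
  have z: "e i = 0" if i: "i \<le> d" "i \<noteq> j" for i
  proof -
    have "inner (disjointness f) (e i) = \<theta> i * inner (e i) (e i)"
      unfolding Df using inner_orthogonal_sum[of d e i \<theta>] e(5) i by simp
    moreover have "inner f (e i) = inner (e i) (e i)"
      using inner_orthogonal_sum[of d e i "\<lambda>_. 1"] e(1,5) i by simp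
    ultimately have "(\<theta> i - \<mu>) * inner (e i) (e i) = 0" using assms(2) by (auto simp: algebra_simps)
    then have "\<theta> i = \<mu> \<or> e i = 0" by simp
    then show ?thesis using assms(3) i by auto
  qed
  have "f = (\<Sum>i\<in>{j}. e i)" unfolding e(1) using z assms(4)
    by (intro sum.mono_neutral_right) auto
  then have "f = e j" by simp
  then show "f \<in> W (Suc j)" "\<And>g. g \<in> W j \<Longrightarrow> inner f g = 0" using e assms(4) by auto
qed

lemma supported_in_W:
  assumes "\<And>U. U \<notin> G \<Longrightarrow> f $ U = 0" shows "f \<in> W (Suc d)"
proof -
  have "{V\<in>G. U \<subseteq> V} = {U}" if "U \<in> G" for U
  proof -
    have "V = U" if "V \<in> G" "U \<subseteq> V" for V
      using that \<open>U \<in> G\<close> by (metis generatorD(1,2) vec.subspace_dim_equal order_refl)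
    then show ?thesis using that by auto
  qed
  then have "f = (\<Sum>U\<in>G. (f $ U) *\<^sub>R pencil U)"
    using assms by (auto simp: vec_eq_iff if_distrib cong: if_cong)
  moreover have "pencil U \<in> W (Suc d)" if "U \<in> G" for U
    using generatorD[OF that] by (intro pencil_in_W) auto
  ultimately show ?thesis
    by (metis (no_types, lifting) subspace_W subspace_scale subspace_sum)
qed

end

section \<open>The eigenvalue bound and its case of equality\<close>

text \<open>
Let \<open>S\<close> be the sum and \<open>P\<close> the product of \<open>\<alpha>\<close> and \<open>\<beta>\<close>. The bound from above limits \<open>S\<close> in terms
of \<open>P\<close>, and with the bound from below this gives \<open>S\<^sup>2 \<le> 4 * P\<close>, which is the reverse of the
inequality between arithmetic and geometric mean.
\<close>
lemma ratio_bound_equality: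
  fixes \<alpha> \<beta> N Q :: real
  assumes "N > 0" "Q > 1" "\<alpha> \<ge> 0" "\<beta> \<ge> 0"
    and low: "N\<^sup>2 \<le> \<alpha> * \<beta> * (Q + 1)\<^sup>2"
    and up: "Q\<^sup>2 * (\<alpha> * \<beta>) \<le> (N - \<alpha>) * (N - \<beta>)"
  shows "\<alpha> = N / (Q + 1)" "\<beta> = N / (Q + 1)"
proof -
  define S where "S = \<alpha> + \<beta>"
  define P where "P = \<alpha> * \<beta>"
  have 1: "(Q\<^sup>2 - 1) * P \<le> N * (N - S)" using up by (simp add: S_def P_def algebra_simps power2_eq_square)
  have Q: "Q\<^sup>2 - 1 = (Q - 1) * (Q + 1)" by (simp add: algebra_simps power2_eq_square)
  have "(Q\<^sup>2 - 1) * N\<^sup>2 \<le> (Q\<^sup>2 - 1) * (P * (Q + 1)\<^sup>2)"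
    using low assms(2) by (intro mult_left_mono) (auto simp: P_def Q)
  also have "\<dots> \<le> (N * (N - S)) * (Q + 1)\<^sup>2"
    using mult_right_mono[OF 1, of "(Q + 1)\<^sup>2"] by (simp add: mult_ac)
  finally have "(N * (Q + 1)) * ((Q - 1) * N) \<le> (N * (Q + 1)) * ((N - S) * (Q + 1))"
    unfolding Q by (simp add: power2_eq_square mult_ac)
  moreover have "N * (Q + 1) > 0" using assms by simp
  ultimately have "(Q - 1) * N \<le> (N - S) * (Q + 1)" by (simp only: mult_le_cancel_left_pos)
  then have S: "S * (Q + 1) \<le> 2 * N" by (simp add: algebra_simps)
  have "0 \<le> S * (Q + 1)" using assms by (simp add: S_def)
  then have "(S * (Q + 1))\<^sup>2 \<le> (2 * N)\<^sup>2" using S by (intro power_mono)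
  also have "\<dots> \<le> 4 * P * (Q + 1)\<^sup>2" using low by (simp add: P_def power_mult_distrib mult_ac)
  finally have "S\<^sup>2 * (Q + 1)\<^sup>2 \<le> 4 * P * (Q + 1)\<^sup>2" by (simp add: power_mult_distrib)
  moreover have "(Q + 1)\<^sup>2 > 0" using assms by simp
  ultimately have "S\<^sup>2 \<le> 4 * P" by (simp only: mult_le_cancel_right_pos)
  then have "(\<alpha> - \<beta>)\<^sup>2 \<le> 0" by (simp add: S_def P_def power2_eq_square algebra_simps)
  then have ab: "\<alpha> = \<beta>" by simp
  then have "N\<^sup>2 \<le> (\<alpha> * (Q + 1))\<^sup>2" using low by (simp add: power2_eq_square mult_ac)
  then have "N \<le> \<alpha> * (Q + 1)" by (rule power2_le_imp_le) (use assms in simp)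
  then have "\<alpha> * (Q + 1) = N" using S ab by (simp add: S_def algebra_simps)
  then show "\<alpha> = N / (Q + 1)" "\<beta> = N / (Q + 1)" using ab assms by (auto simp: field_simps)
qed

context symplectic_space
begin

lemma inner_ind_ind: "inner (ind A) (ind C) = real (card (A \<inter> C))"
  by (simp add: inner_ind sum.If_cases Int_commute)

lemma pencil_zero: "pencil {0} = ind G"
proof -
  have "{U \<in> G. {0} \<subseteq> U} = G" using generatorD(1) by (auto simp: vec.subspace_0)
  then show ?thesis by simp
qed

lemma totally_isotropic_zero: "totally_isotropic B {0}"
  by (auto simp: totally_isotropic_def vec.subspace_single_0)

lemma disjointness_ind_G: "disjointness (ind G) = (q ^ d * lam) *\<^sub>R ind G"
proof -
  have "{U \<in> G. U \<inter> {0} = {0}} = G" using generatorD(1) by (auto simp: vec.subspace_0)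
  moreover have "Suc d choose 2 = d + (d choose 2)" by (simp add: numeral_2_eq_2)
  ultimately show ?thesis
    using disjointness_pencil[OF totally_isotropic_zero] pencil_zero by (simp add: lam_def power_add)
qed

text \<open>
The average size of a point pencil, by counting incident pairs of a nonzero vector and a generator.
\<close>
lemma large_point_pencil:
  obtains x where "x \<noteq> 0" "real (card G) \<le> real (card {U\<in>G. x \<in> U}) * (q ^ d + 1)"
proof (rule ccontr)
  assume "\<not> thesis"
  then have less: "real (card {U\<in>G. x \<in> U}) * (q ^ d + 1) < real (card G)" if "x \<noteq> 0" for x
    using that \<open>_ \<Longrightarrow> _ \<Longrightarrow> thesis\<close> by (meson not_le)
  let ?S = "UNIV - {0} :: ('a ^ 'n) set"
  have S: "real (card ?S) = q ^ (2 * d) - 1"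
    using card_subspace_Diff[of UNIV "{0}"] dim_V by (simp add: vec.subspace_single_0 del: vec.dim_UNIV)
  have "q ^ (2 * d) > 1" using one_less_power[OF q_gt_1] d_pos by simp
  then have ne: "?S \<noteq> {}" using S by (metis card.empty diff_gt_0_iff_gt less_irrefl of_nat_0)
  have "(\<Sum>x\<in>?S. real (card {U\<in>G. x \<in> U}) * (q ^ d + 1)) < (\<Sum>x\<in>?S. real (card G))"
    by (rule sum_strict_mono) (use ne less in auto)
  also have "(\<Sum>x\<in>?S. real (card {U\<in>G. x \<in> U}) * (q ^ d + 1))
     = (q ^ d + 1) * (\<Sum>x\<in>?S. real (card {U\<in>G. x \<in> U}))"
    by (simp add: sum_distrib_left mult.commute)
  also have "(\<Sum>x\<in>?S. real (card {U\<in>G. x \<in> U})) = (\<Sum>U\<in>G. real (card {x\<in>?S. x \<in> U}))"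
    by (rule double_count[symmetric]) simp_all
  also have "\<dots> = (\<Sum>U\<in>G. q ^ d - 1)"
  proof (rule sum.cong[OF refl])
    fix U assume U: "U \<in> G"
    have "{x\<in>?S. x \<in> U} = U - {0}" by auto
    then show "real (card {x\<in>?S. x \<in> U}) = q ^ d - 1"
      using card_subspace_Diff[of U "{0}"] generatorD(1,2)[OF U]
      by (simp add: vec.subspace_single_0 vec.subspace_0)
  qed
  finally have "(q ^ d + 1) * (real (card G) * (q ^ d - 1)) < (q ^ (2 * d) - 1) * real (card G)"
    using S by simp
  moreover have "(q ^ d + 1) * (real (card G) * (q ^ d - 1)) = (q ^ (2 * d) - 1) * real (card G)"
    unfolding mult_2 power_add by (simp add: algebra_simps)
  ultimately show False by simp
qed

lemma maximum_product_lower_bound: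
  assumes "maximum_cross_intersecting_EKR d B Y Z"
  shows "(real (card G))\<^sup>2 \<le> real (card Y) * real (card Z) * (q ^ d + 1)\<^sup>2"
proof -
  obtain x where x: "x \<noteq> 0" "real (card G) \<le> real (card {U\<in>G. x \<in> U}) * (q ^ d + 1)"
    by (rule large_point_pencil)
  let ?P = "{U\<in>G. x \<in> U}"
  have "vec.dim (y \<inter> z) \<ge> 1" if "y \<in> ?P" "z \<in> ?P" for y z
  proof -
    have "\<not> y \<inter> z \<subseteq> {0}" using that x by auto
    then have "vec.dim (y \<inter> z) \<noteq> 0" by simp
    then show ?thesis by linarith
  qed
  then have "cross_intersecting_EKR d B ?P ?P" by (auto simp: cross_intersecting_EKR_def)
  then have "card ?P * card ?P \<le> card Y * card Z"
    using assms by (simp add: maximum_cross_intersecting_EKR_def)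
  then have le: "real (card ?P) * real (card ?P) \<le> real (card Y) * real (card Z)"
    by (simp flip: of_nat_mult)
  have "(real (card G))\<^sup>2 \<le> (real (card ?P) * (q ^ d + 1))\<^sup>2" using x(2) by (intro power_mono) auto
  also have "\<dots> = real (card ?P) * real (card ?P) * (q ^ d + 1)\<^sup>2"
    by (simp add: power_mult_distrib power2_eq_square)
  also have "\<dots> \<le> real (card Y) * real (card Z) * (q ^ d + 1)\<^sup>2"
    by (rule mult_right_mono[OF le]) simp
  finally show ?thesis .
qed

lemma ind_in_W: "A \<subseteq> G \<Longrightarrow> ind A \<in> W (Suc d)"
  by (rule supported_in_W) auto

text \<open>
The cross-intersecting form of the Hoffman bound. Let \<open>u\<close> and \<open>v\<close> be the components of the two
indicator functions orthogonal to the constants. That no member of \<open>Y\<close> is disjoint from a member of \<open>Z\<close>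
fixes the inner product of \<open>disjointness u\<close> with \<open>v\<close>, and the spectral bound with Cauchy--Schwarz limits
the product of the two sizes. A point pencil is large enough to force equality throughout, so that
\<open>disjointness u = - lam *\<^sub>R v\<close>.
\<close>
lemma disjointness_maximum:
  assumes max: "maximum_cross_intersecting_EKR d B Y Z" and ne: "G \<noteq> {}"
  shows "disjointness (ind Y) = lam *\<^sub>R (ind G - ind Z)"
    "real (card Y) = real (card G) / (q ^ d + 1)"
proof -
  have YZ: "Y \<subseteq> G" "Z \<subseteq> G" and ci: "\<And>y z. y \<in> Y \<Longrightarrow> z \<in> Z \<Longrightarrow> vec.dim (y \<inter> z) \<ge> 1"
    using max by (auto simp: maximum_cross_intersecting_EKR_def cross_intersecting_EKR_def)
  define N where "N = real (card G)"
  define \<alpha> where "\<alpha> = real (card Y)"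
  define \<beta> where "\<beta> = real (card Z)"
  define Q where "Q = q ^ d"
  have N: "N > 0" using ne by (simp add: N_def card_gt_0_iff)
  have Q: "Q > 1" using one_less_power[OF q_gt_1 d_pos] by (simp add: Q_def)
  have low: "N\<^sup>2 \<le> \<alpha> * \<beta> * (Q + 1)\<^sup>2"
    using maximum_product_lower_bound[OF max] by (simp add: N_def \<alpha>_def \<beta>_def Q_def)
  have ab: "\<alpha> * \<beta> > 0"
  proof -
    have "\<alpha> * \<beta> * (Q + 1)\<^sup>2 > 0" using low N zero_less_power[of N 2] by linarith
    then show ?thesis by (simp add: zero_less_mult_iff \<alpha>_def \<beta>_def)
  qed
  define u where "u = ind Y - (\<alpha> / N) *\<^sub>R ind G"
  define v where "v = ind Z - (\<beta> / N) *\<^sub>R ind G"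
  have inn: "inner (ind Y) (ind Y) = \<alpha>" "inner (ind Z) (ind Z) = \<beta>"
     "inner (ind Y) (ind G) = \<alpha>" "inner (ind Z) (ind G) = \<beta>" 
     "inner (ind G) (ind Y) = \<alpha>" "inner (ind G) (ind Z) = \<beta>" 
     "inner (ind G) (ind G) = N"
    using YZ by (simp_all add: inner_ind_ind \<alpha>_def \<beta>_def N_def Int_absorb1 Int_absorb2)
  have uu: "inner u u = \<alpha> * (N - \<alpha>) / N" and vv: "inner v v = \<beta> * (N - \<beta>) / N"
    and "inner u (ind G) = 0"
    using N by (simp_all add: u_def v_def inner_diff_left inner_diff_right inn field_simps)
  then have uG: "inner u (pencil {0}) = 0" by (simp only: pencil_zero)
  have DG: "disjointness (ind G) = (Q * lam) *\<^sub>R ind G" using disjointness_ind_G by (simp add: Q_def)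
  have Du: "disjointness u = disjointness (ind Y) - (\<alpha> / N * (Q * lam)) *\<^sub>R ind G"
    by (simp add: u_def linear_diff[OF linear_disjointness] linear_cmul[OF linear_disjointness] DG)
  have DYZ: "inner (disjointness (ind Y)) (ind Z) = 0"
    unfolding inner_ind
  proof (intro sum.neutral ballI)
    fix z assume z: "z \<in> Z"
    have "ind Y $ y = 0" if "y \<inter> z = {0}" for y
    proof -
      have "vec.dim (y \<inter> z) = 0" using that by simp
      then have "y \<notin> Y" using ci[of y z] z by (metis not_one_le_zero)
      then show ?thesis by simp
    qed
    then show "disjointness (ind Y) $ z = 0" by (simp add: disjointness_def sum.neutral)
  qed
  have DYG: "inner (disjointness (ind Y)) (ind G) = Q * lam * \<alpha>"
    by (simp add: disjointness_symmetric DG inn)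
  have Duv: "inner (disjointness u) v = - (Q * lam * \<alpha> * \<beta> / N)"
    using N by (simp add: Du v_def inner_diff_left inner_diff_right inn DYZ DYG field_simps)
  have uW: "u \<in> W (Suc d)" using YZ by (intro supported_in_W) (auto simp: u_def)
  have DuDu: "inner (disjointness u) (disjointness u) \<le> lam\<^sup>2 * inner u u"
    by (rule spectral_bound[OF uW uG])
  have "(Q * lam * \<alpha> * \<beta> / N)\<^sup>2 \<le> inner (disjointness u) (disjointness u) * inner v v"
    using Cauchy_Schwarz_ineq[of "disjointness u" v] by (simp add: Duv)
  also have "\<dots> \<le> lam\<^sup>2 * inner u u * inner v v"
    by (rule mult_right_mono[OF DuDu]) simp
  finally have "(lam\<^sup>2 * (\<alpha> * \<beta>) / N\<^sup>2) * (Q\<^sup>2 * (\<alpha> * \<beta>)) \<le> (lam\<^sup>2 * (\<alpha> * \<beta>) / N\<^sup>2) * ((N - \<alpha>) * (N - \<beta>))"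
    unfolding uu vv by (simp add: power2_eq_square mult_ac)
  moreover have "lam\<^sup>2 * (\<alpha> * \<beta>) / N\<^sup>2 > 0" using ab N lam_pos by simp
  ultimately have up: "Q\<^sup>2 * (\<alpha> * \<beta>) \<le> (N - \<alpha>) * (N - \<beta>)" by (simp only: mult_le_cancel_left_pos)
  have eq: "\<alpha> = N / (Q + 1)" "\<beta> = N / (Q + 1)"
    using ratio_bound_equality[OF N Q _ _ low up] by (auto simp: \<alpha>_def \<beta>_def)
  show "real (card Y) = real (card G) / (q ^ d + 1)" using eq by (simp add: \<alpha>_def N_def Q_def)
  have "inner (disjointness u + lam *\<^sub>R v) (disjointness u + lam *\<^sub>R v)
     = inner (disjointness u) (disjointness u) + 2 * lam * inner (disjointness u) v + lam\<^sup>2 * inner v v"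
    by (simp add: inner_add_left inner_add_right inner_commute[of v "disjointness u"]
        power2_eq_square algebra_simps)
  also have "\<dots> \<le> lam\<^sup>2 * inner u u + 2 * lam * inner (disjointness u) v + lam\<^sup>2 * inner v v"
    using DuDu by simp
  also have "\<dots> = 2 * lam\<^sup>2 * (\<alpha> * (N - \<alpha>) / N - Q * \<alpha> * \<alpha> / N)"
    unfolding uu vv Duv using eq by (simp add: algebra_simps power2_eq_square)
  also have "\<alpha> * (N - \<alpha>) / N - Q * \<alpha> * \<alpha> / N = \<alpha> * (N - (Q + 1) * \<alpha>) / N"
    by (simp add: diff_divide_distrib[symmetric] algebra_simps)
  also have "(Q + 1) * \<alpha> = N" using eq Q by simp
  finally have "inner (disjointness u + lam *\<^sub>R v) (disjointness u + lam *\<^sub>R v) \<le> 0" by simp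
  then have "disjointness u + lam *\<^sub>R v = 0" by (meson inner_ge_zero inner_eq_zero_iff order_antisym)
  then have "disjointness (ind Y) = (\<alpha> / N * (Q * lam) + lam * (\<beta> / N)) *\<^sub>R ind G - lam *\<^sub>R ind Z"
    by (simp add: Du v_def algebra_simps)
  also have "\<alpha> / N * (Q * lam) + lam * (\<beta> / N) = lam"
  proof -
    have "\<alpha> / N = 1 / (Q + 1)" "\<beta> / N = 1 / (Q + 1)" using eq N Q by auto
    moreover have "c * (Q * lam) + lam * c = lam * (c * (Q + 1))" for c
      by (simp add: algebra_simps)
    ultimately have "\<alpha> / N * (Q * lam) + lam * (\<beta> / N) = lam * (1 / (Q + 1) * (Q + 1))"
      by (simp only:)
    then show ?thesis using Q by simp
  qed
  finally show "disjointness (ind Y) = lam *\<^sub>R (ind G - ind Z)" by (simp add: scaleR_diff_right)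
qed

text \<open>
A member of \<open>W 2\<close> is a combination of point pencils and of the constant function. The constant can be
spread over the nonzero vectors of each generator, so the weight of the zero vector may be taken to
vanish.
\<close>
lemma W_2_point_weights:
  assumes "f \<in> W 2"
  obtains h :: "'a ^ 'n \<Rightarrow> real" where "h 0 = 0" "\<And>U. U \<in> G \<Longrightarrow> f $ U = sum h U"
proof -
  let ?S = "{f :: real ^ (('a ^ 'n) set). \<exists>h :: 'a ^ 'n \<Rightarrow> real. h 0 = 0 \<and> (\<forall>U\<in>G. f $ U = sum h U)}"
  have "W 2 \<subseteq> ?S" unfolding W_def
  proof (rule span_minimal)
    show "subspace ?S"
    proof (rule subspaceI)
      show "0 \<in> ?S" by (auto intro!: exI[of _ "\<lambda>_. 0"])
    next
      fix f g assume "f \<in> ?S" "g \<in> ?S"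
      then obtain h h' where "h 0 = 0" "\<forall>U\<in>G. f $ U = sum h U" "h' 0 = 0" "\<forall>U\<in>G. g $ U = sum h' U"
        by blast
      then show "f + g \<in> ?S" by (auto intro!: exI[of _ "\<lambda>x. h x + h' x"] simp: sum.distrib)
    next
      fix c f assume "f \<in> ?S"
      then obtain h where "h 0 = 0" "\<forall>U\<in>G. f $ U = sum h U" by blast
      then show "c *\<^sub>R f \<in> ?S" by (auto intro!: exI[of _ "\<lambda>x. c * h x"] simp: sum_distrib_left)
    qed
    have "pencil K \<in> ?S" if K: "totally_isotropic B K" "vec.dim K < 2" for K
    proof (cases "vec.dim K = 0")
      case True
      then have "K \<subseteq> {0}" "0 \<in> K" using K by (auto simp: totally_isotropic_def vec.subspace_0)
      then have K0: "K = {0}" by auto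
      have "q ^ d - 1 \<noteq> 0" using one_less_power[OF q_gt_1 d_pos] by simp
      moreover have "(\<Sum>x\<in>U. if x = 0 then 0 else 1 / (q ^ d - 1)) = real (card (U - {0})) / (q ^ d - 1)" for U :: "('a ^ 'n) set"
        by (simp add: sum.If_cases Diff_eq Collect_neg_eq)
      moreover have "real (card (U - {0})) = q ^ d - 1" if "U \<in> G" for U
        using card_subspace_Diff[of U "{0}"] generatorD(1,2)[OF that]
        by (simp add: vec.subspace_single_0 vec.subspace_0)
      ultimately show ?thesis unfolding K0 pencil_zero
        by (intro CollectI exI[of _ "\<lambda>x. if x = 0 then 0 else 1 / (q ^ d - 1)"]) simp
    next
      case False
      then obtain x where x: "x \<in> K" "x \<noteq> 0" by auto
      have sK: "vec.subspace K" using K by (simp add: totally_isotropic_def)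
      have "vec.dim (vec.span {x}) = 1" using x(2) by simp
      then have "vec.span {x} = K" using K x sK
        by (intro vec.subspace_dim_equal) (auto simp: vec.span_minimal)
      then have "K \<subseteq> U \<longleftrightarrow> x \<in> U" if "U \<in> G" for U
        using x generatorD(1)[OF that] by (metis empty_subsetI insert_subset subsetD vec.span_minimal)
      then show ?thesis using x(2)
        by (intro CollectI exI[of _ "\<lambda>y. if y = x then 1 else 0"]) auto
    qed
    then show "{pencil K |K. totally_isotropic B K \<and> vec.dim K < 2} \<subseteq> ?S" by blast
  qed
  with assms that show ?thesis by blast
qed

section \<open>Sums of vector weights over generators\<close>

lemma card_trace_through_point:
  assumes z: "z \<in> G" and J: "vec.subspace J" "J \<subseteq> z" and x: "x \<notin> z" "x \<in> perp J"
  shows "real (card {U\<in>G. U \<inter> z = J \<and> x \<in> U}) = q ^ ((d - vec.dim J) choose 2)"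
proof -
  note zD = generatorD[OF z]
  have TJ: "totally_isotropic B J" using totally_isotropic_subset[OF zD(3)] J by blast
  have xJ: "x \<notin> J" using x J by auto
  have i: "adjoin x J \<inter> z = J" by (rule adjoin_Int[OF zD(1) J x(1)])
  have "{U\<in>G. U \<inter> z = J \<and> x \<in> U} = {U\<in>G. adjoin x J \<subseteq> U \<and> U \<inter> z \<subseteq> adjoin x J}"
  proof (rule Collect_cong, rule conj_cong[OF refl])
    fix U assume U: "U \<in> G"
    show "U \<inter> z = J \<and> x \<in> U \<longleftrightarrow> adjoin x J \<subseteq> U \<and> U \<inter> z \<subseteq> adjoin x J"
      unfolding adjoin_subset_iff[OF generatorD(1)[OF U]] using i J(2) by blast
  qed
  moreover have d: "vec.dim (adjoin x J) = Suc (vec.dim J)" using dim_adjoin[OF J(1) xJ] .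
  moreover have "Suc (d - vec.dim (adjoin x J)) = d - vec.dim J"
    using totally_isotropic_dim[OF totally_isotropic_adjoin[OF TJ x(2)]] d by simp
  ultimately show ?thesis
    using card_generators_meeting_in[OF totally_isotropic_adjoin[OF TJ x(2)] z] by simp
qed

text \<open>
Exchange the sums over generators and over their vectors. A vector of \<open>z\<close> outside \<open>J\<close>, or one not
perpendicular to \<open>J\<close>, lies in none of the generators considered.
\<close>
lemma sum_weights_trace:
  fixes h :: "'a ^ 'n \<Rightarrow> real"
  assumes z: "z \<in> G" and J: "vec.subspace J" "J \<subseteq> z"
  shows "(\<Sum>U\<in>{U\<in>G. U \<inter> z = J}. sum h U)
    = q ^ (Suc (d - vec.dim J) choose 2) * sum h J + q ^ ((d - vec.dim J) choose 2) * sum h (perp J - z)"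
proof -
  note zD = generatorD[OF z]
  have TJ: "totally_isotropic B J" using totally_isotropic_subset[OF zD(3)] J by blast
  let ?A = "{U\<in>G. U \<inter> z = J}"
  let ?a = "q ^ (Suc (d - vec.dim J) choose 2)" and ?b = "q ^ ((d - vec.dim J) choose 2)"
  have "(\<Sum>U\<in>?A. sum h U) = (\<Sum>U\<in>?A. \<Sum>x\<in>UNIV. if x \<in> U then h x else 0)"
    by (simp add: sum.If_cases)
  also have "\<dots> = (\<Sum>x\<in>UNIV. \<Sum>U\<in>?A. if x \<in> U then h x else 0)" by (rule sum.swap)
  also have "\<dots> = (\<Sum>x\<in>UNIV. real (card {U\<in>G. U \<inter> z = J \<and> x \<in> U}) * h x)"
    by (intro sum.cong refl) (simp add: sum.If_cases Collect_conj_eq[symmetric] conj_ac flip: Collect_conj_eq)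
  also have "\<dots> = (\<Sum>x\<in>UNIV. (if x \<in> J then ?a * h x else 0) + (if x \<in> perp J - z then ?b * h x else 0))"
  proof (rule sum.cong[OF refl])
    fix x
    consider "x \<in> J" | "x \<in> z" "x \<notin> J" | "x \<notin> z" "x \<in> perp J" | "x \<notin> z" "x \<notin> perp J" by blast
    then show "real (card {U\<in>G. U \<inter> z = J \<and> x \<in> U}) * h x
       = (if x \<in> J then ?a * h x else 0) + (if x \<in> perp J - z then ?b * h x else 0)"
    proof cases
      case 1
      then have "{U\<in>G. U \<inter> z = J \<and> x \<in> U} = {U\<in>G. J \<subseteq> U \<and> U \<inter> z \<subseteq> J}" using J by blast
      then show ?thesis using card_generators_meeting_in[OF TJ z] 1 J by auto
    next
      case 2
      then have "{U\<in>G. U \<inter> z = J \<and> x \<in> U} = {}" by blast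
      then show ?thesis using 2 by simp
    next
      case 3
      then show ?thesis using card_trace_through_point[OF z J] J by auto
    next
      case 4
      have "x \<notin> U" if U: "U \<in> G" "U \<inter> z = J" for U
        using 4 generatorD(4)[OF U(1)] perp_antimono[of J U] U(2) by auto
      then have "{U\<in>G. U \<inter> z = J \<and> x \<in> U} = {}" by auto
      then show ?thesis using 4 J by auto
    qed
  qed
  also have "\<dots> = ?a * sum h J + ?b * sum h (perp J - z)"
    by (simp add: sum.distrib sum.If_cases sum_distrib_left del: Diff_iff)
  finally show ?thesis .
qed

lemma dim_Int_perp_point:
  assumes y: "y \<in> G" and x: "x \<notin> y" shows "Suc (vec.dim (y \<inter> perp {x})) = d"
proof -
  note yD = generatorD[OF y]
  have s: "vec.subspace (y \<inter> perp {x})" by (intro vec.subspace_inter yD subspace_perp)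
  have "vec.dim (y \<inter> perp {x}) \<noteq> d"
  proof
    assume "vec.dim (y \<inter> perp {x}) = d"
    then have "y \<inter> perp {x} = y" using yD s by (intro vec.subspace_dim_equal) auto
    then have "x \<in> perp y" by (auto simp: perp_def B_eq_0_commute[of x])
    then show False using x yD(4) by simp
  qed
  moreover have "vec.dim (y \<inter> perp {x}) \<le> d" using vec.dim_subset[of "y \<inter> perp {x}" y] yD(2) by simp
  ultimately show ?thesis using dim_Int_perp_singleton[OF yD(1), of x] yD(2) by linarith
qed

lemma perp_Int_perp_point:
  assumes y: "y \<in> G" and x: "x \<notin> y" shows "perp (y \<inter> perp {x}) = adjoin x y"
proof (rule vec.subspace_dim_equal[symmetric])
  note yD = generatorD[OF y]
  have s: "vec.subspace (y \<inter> perp {x})" by (intro vec.subspace_inter yD subspace_perp)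
  have "y \<subseteq> perp (y \<inter> perp {x})" using yD(4) perp_antimono[of "y \<inter> perp {x}" y] by auto
  moreover have "x \<in> perp (y \<inter> perp {x})" by (auto simp: perp_def B_eq_0_commute[of _ x])
  ultimately show "adjoin x y \<subseteq> perp (y \<inter> perp {x})" by (simp add: vec.span_minimal)
  show "vec.dim (perp (y \<inter> perp {x})) \<le> vec.dim (adjoin x y)"
    using dim_perp[OF s] dim_Int_perp_point[OF y x] dim_adjoin[OF yD(1) x] yD(2) by simp
qed auto

lemma adjoin_swap:
  assumes y: "vec.subspace y" and x: "x \<notin> y" "x' \<notin> y"
  shows "x' \<in> adjoin x y \<longleftrightarrow> x \<in> adjoin x' y"
proof -
  have "x \<in> adjoin x' y" if "x' \<in> adjoin x y" "x' \<notin> y" for x x'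
  proof -
    have "x' \<notin> vec.span y" using that y by (metis vec.span_eq_iff)
    then show ?thesis using vec.in_span_insert that by blast
  qed
  then show ?thesis using x by blast
qed

text \<open>
The hyperplanes of a generator \<open>y\<close> that contain \<open>R\<close> are the spaces \<open>y \<inter> perp {x}\<close> for \<open>x\<close> in \<open>perp R\<close>
outside \<open>y\<close>; summing over \<open>x\<close> weights them all equally. The summand is the total weight of the
generators other than \<open>y\<close> through such a hyperplane, see \<open>sum_weights_trace\<close>.
\<close>
lemma sum_tangent_weights:
  fixes h :: "'a ^ 'n \<Rightarrow> real"
  assumes y: "y \<in> G" and R: "vec.subspace R" "R \<subseteq> y" "R \<noteq> y"
  shows "(\<Sum>x\<in>perp R - y. q * sum h (y \<inter> perp {x}) + sum h (perp (y \<inter> perp {x}) - y))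
   = q * (sum h R * (q ^ (2 * d - vec.dim R) - q ^ d)
        + sum h (y - R) * (q ^ (2 * d - vec.dim R - 1) - q ^ d))
     + (q ^ Suc d - q ^ d) * sum h (perp R - y)"
proof -
  note yD = generatorD[OF y]
  let ?X = "perp R - y"
  have yR: "y \<subseteq> perp R" using R(2) yD(4) perp_antimono[of R y] by auto
  have dR: "vec.dim (perp R) = 2 * d - vec.dim R" using dim_perp[OF R(1)] by linarith
  have "(\<Sum>x\<in>?X. sum h (y \<inter> perp {x})) = (\<Sum>x\<in>?X. \<Sum>v\<in>y. if B v x = 0 then h v else 0)"
  proof (rule sum.cong[OF refl])
    fix x
    have "y \<inter> perp {x} = y \<inter> {v. B v x = 0}" by (auto simp: perp_def B_eq_0_commute[of x])
    then show "sum h (y \<inter> perp {x}) = (\<Sum>v\<in>y. if B v x = 0 then h v else 0)"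
      by (simp add: sum.If_cases)
  qed
  also have "\<dots> = (\<Sum>v\<in>y. \<Sum>x\<in>?X. if B v x = 0 then h v else 0)" by (rule sum.swap)
  also have "\<dots> = (\<Sum>v\<in>y. real (card (perp (insert v R) - y)) * h v)"
  proof (rule sum.cong[OF refl])
    fix v
    have "?X \<inter> {x. B v x = 0} = perp (insert v R) - y" by (auto simp: perp_def)
    then show "(\<Sum>x\<in>?X. if B v x = 0 then h v else 0) = real (card (perp (insert v R) - y)) * h v"
      by (simp add: sum.If_cases del: Diff_iff)
  qed
  also have "\<dots> = (\<Sum>v\<in>y. if v \<in> R then (q ^ (2 * d - vec.dim R) - q ^ d) * h v
       else (q ^ (2 * d - vec.dim R - 1) - q ^ d) * h v)"
  proof (rule sum.cong[OF refl])
    fix v assume v: "v \<in> y"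
    have sub: "y \<subseteq> perp (insert v R)"
      using v R(2) yD(4) perp_antimono[of "insert v R" y] by auto
    have "vec.dim (perp (insert v R)) = 2 * d - vec.dim R - (if v \<in> R then 0 else 1)"
      using dR dim_perp[of "adjoin v R"] dim_adjoin[OF R(1), of v]
      by (auto simp: insert_absorb)
    then show "real (card (perp (insert v R) - y)) * h v
      = (if v \<in> R then (q ^ (2 * d - vec.dim R) - q ^ d) * h v
       else (q ^ (2 * d - vec.dim R - 1) - q ^ d) * h v)"
      using card_subspace_Diff[OF subspace_perp yD(1) sub] yD(2) by simp
  qed
  also have "\<dots> = sum h R * (q ^ (2 * d - vec.dim R) - q ^ d)
        + sum h (y - R) * (q ^ (2 * d - vec.dim R - 1) - q ^ d)"
    using R(2) by (simp add: sum.If_cases Int_absorb1 Diff_eq sum_distrib_right mult.commute Collect_neg_eq)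
  finally have 1: "(\<Sum>x\<in>?X. sum h (y \<inter> perp {x})) = sum h R * (q ^ (2 * d - vec.dim R) - q ^ d)
        + sum h (y - R) * (q ^ (2 * d - vec.dim R - 1) - q ^ d)" .
  have "(\<Sum>x\<in>?X. sum h (perp (y \<inter> perp {x}) - y)) = (\<Sum>x\<in>?X. \<Sum>x'\<in>?X. if x' \<in> adjoin x y then h x' else 0)"
  proof (rule sum.cong[OF refl])
    fix x assume x: "x \<in> ?X"
    then have "adjoin x y \<subseteq> perp R" using yR by (simp add: vec.span_minimal)
    then have "?X \<inter> adjoin x y = perp (y \<inter> perp {x}) - y" using perp_Int_perp_point[OF y, of x] x by auto
    then show "sum h (perp (y \<inter> perp {x}) - y) = (\<Sum>x'\<in>?X. if x' \<in> adjoin x y then h x' else 0)"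
      by (simp add: sum.If_cases del: Diff_iff)
  qed
  also have "\<dots> = (\<Sum>x'\<in>?X. \<Sum>x\<in>?X. if x' \<in> adjoin x y then h x' else 0)" by (rule sum.swap)
  also have "\<dots> = (\<Sum>x'\<in>?X. (q ^ Suc d - q ^ d) * h x')"
  proof (rule sum.cong[OF refl])
    fix x' assume x': "x' \<in> ?X"
    have "adjoin x' y \<subseteq> perp R" using x' yR by (simp add: vec.span_minimal)
    then have "?X \<inter> {x. x' \<in> adjoin x y} = adjoin x' y - y"
      using adjoin_swap[OF yD(1), of _ x'] x' by blast
    then have "(\<Sum>x\<in>?X. if x' \<in> adjoin x y then h x' else 0) = real (card (adjoin x' y - y)) * h x'"
      by (simp add: sum.If_cases del: Diff_iff)
    also have "real (card (adjoin x' y - y)) = q ^ Suc d - q ^ d"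
      using card_subspace_Diff[of "adjoin x' y" y] adjoin_superset[where J = y and v = x']
        dim_adjoin[of y x'] x' yD(1,2) by simp
    finally show "(\<Sum>x\<in>?X. if x' \<in> adjoin x y then h x' else 0) = (q ^ Suc d - q ^ d) * h x'" .
  qed
  finally have "(\<Sum>x\<in>?X. sum h (perp (y \<inter> perp {x}) - y)) = (q ^ Suc d - q ^ d) * sum h ?X"
    by (simp add: sum_distrib_left)
  with 1 show ?thesis by (simp add: sum.distrib flip: sum_distrib_left)
qed

end

section \<open>Pairs attaining the bound\<close>

text \<open>
What the spectral analysis says about a maximum pair in even rank, in a form symmetric in \<open>Y\<close> and \<open>Z\<close>.
The difference of the indicator functions belongs to the top layer, orthogonal to \<open>W d\<close>; the sum of
the indicator functions belongs to \<open>W 2\<close> and is given by weights \<open>h\<close> of the vectors.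
\<close>
locale extremal_pair = symplectic_space B d q
  for B :: "'a::{field,finite} ^ 'n \<Rightarrow> 'a ^ 'n \<Rightarrow> 'a" and d :: nat and q :: real +
  fixes Y Z :: "('a ^ 'n) set set" and h :: "'a ^ 'n \<Rightarrow> real"
  assumes Y_G: "Y \<subseteq> G" and Z_G: "Z \<subseteq> G"
    and disj_Y: "disjointness (ind Y) = lam *\<^sub>R (ind G - ind Z)"
    and disj_Z: "disjointness (ind Z) = lam *\<^sub>R (ind G - ind Y)"
    and balanced: "\<And>g. g \<in> W d \<Longrightarrow> inner (ind Y) g = inner (ind Z) g"
    and h_0: "h 0 = 0"
    and weights: "\<And>U. U \<in> G \<Longrightarrow> (ind Y + ind Z) $ U = sum h U"

text \<open>
The sum and the difference of \<open>ind Y\<close> and \<open>ind Z\<close> are, up to a constant, eigenvectors for \<open>- lam\<close> and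
\<open>lam\<close>. In even rank these eigenvalues belong to the single indices \<open>1\<close> and \<open>d\<close>.
\<close>
lemma (in symplectic_space) maximum_extremal_pair:
  assumes max: "maximum_cross_intersecting_EKR d B Y Z" and ne: "G \<noteq> {}" and even: "even d"
  obtains h where "extremal_pair B d q Y Z h"
proof -
  have YZ: "Y \<subseteq> G" "Z \<subseteq> G" 
    using max by (auto simp: maximum_cross_intersecting_EKR_def cross_intersecting_EKR_def)
  have "vec.dim (y \<inter> z) \<ge> 1" if "y \<in> Y" "z \<in> Z" for y z
    using max that by (simp add: maximum_cross_intersecting_EKR_def cross_intersecting_EKR_def)
  then have "vec.dim (z \<inter> y) \<ge> 1" if "z \<in> Z" "y \<in> Y" for y z
    using that by (subst Int_commute)
  then have "cross_intersecting_EKR d B Z Y"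
    using YZ by (simp add: cross_intersecting_EKR_def)
  then have max': "maximum_cross_intersecting_EKR d B Z Y"
    using max by (auto simp: maximum_cross_intersecting_EKR_def mult.commute)
  note D = disjointness_maximum(1)[OF max ne] disjointness_maximum(1)[OF max' ne]
  have d2: "d \<noteq> 1" using even by auto
  have lam0: "lam \<noteq> - lam" "lam \<noteq> 0" using lam_pos by auto
  have td: "\<theta> d = lam" using theta_d even by simp
  have w: "inner (ind Y - ind Z) g = 0" if "g \<in> W d" for g
  proof (rule eigenvector_component(2)[OF _ _ _ order_refl that, of _ lam])
    show "ind Y - ind Z \<in> W (Suc d)" using YZ by (intro subspace_diff subspace_W ind_in_W)
    show "disjointness (ind Y - ind Z) = lam *\<^sub>R (ind Y - ind Z)"
      by (simp add: linear_diff[OF linear_disjointness] D scaleR_diff_right)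
    fix i assume "i \<le> d" "\<theta> i = lam"
    then have "i = 1 \<or> i = d" using abs_theta_eqD[of i] lam_pos by auto
    then show "i = d" using \<open>\<theta> i = lam\<close> theta_1 lam0 by auto
  qed
  define s where "s = ind Y + ind Z - (2 / (q ^ d + 1)) *\<^sub>R ind G"
  have Q: "q ^ d + 1 \<noteq> 0" using one_less_power[OF q_gt_1 d_pos] by simp
  have "s \<in> W (Suc 1)"
  proof (rule eigenvector_component(1)[of _ "- lam"])
    show "s \<in> W (Suc d)" unfolding s_def using YZ
      by (intro subspace_diff subspace_add subspace_scale subspace_W ind_in_W) auto
    have c: "2 * lam - (2 / (q ^ d + 1)) * (q ^ d * lam) = lam * (2 / (q ^ d + 1))"
      using Q by (simp add: field_simps)
    have "disjointness s = lam *\<^sub>R (ind G - ind Z) + lam *\<^sub>R (ind G - ind Y)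
        - ((2 / (q ^ d + 1)) * (q ^ d * lam)) *\<^sub>R ind G"
      unfolding s_def by (simp add: linear_diff[OF linear_disjointness] linear_add[OF linear_disjointness]
        linear_cmul[OF linear_disjointness] D disjointness_ind_G)
    also have "\<dots> = (2 * lam - (2 / (q ^ d + 1)) * (q ^ d * lam)) *\<^sub>R ind G - lam *\<^sub>R (ind Y + ind Z)"
      by (simp add: vec_eq_iff algebra_simps del: ind_nth)
    also have "\<dots> = - lam *\<^sub>R s" unfolding c s_def by (simp add: scaleR_diff_right)
    finally show "disjointness s = - lam *\<^sub>R s" .
    fix i assume i: "i \<le> d" "\<theta> i = - lam"
    then have "i = 1 \<or> i = d" using abs_theta_eqD[of i] lam_pos by auto
    then show "i = 1" using i td lam0 by auto
  qed (use d_pos in auto)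
  moreover have "ind G \<in> W (Suc 1)"
    using pencil_in_W[OF totally_isotropic_zero, of "Suc 1"] pencil_zero by simp
  ultimately have "s + (2 / (q ^ d + 1)) *\<^sub>R ind G \<in> W 2"
    unfolding numeral_2_eq_2 One_nat_def by (intro subspace_add subspace_scale subspace_W)
  then have "ind Y + ind Z \<in> W 2" by (simp add: s_def)
  then obtain h where h: "h 0 = 0" "\<And>U. U \<in> G \<Longrightarrow> (ind Y + ind Z) $ U = sum h U"
    using W_2_point_weights by metis
  have "extremal_pair B d q Y Z h"
  proof
    show "inner (ind Y) g = inner (ind Z) g" if "g \<in> W d" for g
      using w[OF that] by (simp add: inner_diff_left)
  qed (use YZ D h in auto)
  then show ?thesis using that by blast
qed

context extremal_pair
begin

lemma extremal_pair_swap: "extremal_pair B d q Z Y h"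
  by unfold_locales (use Y_G Z_G disj_Y disj_Z balanced h_0 weights in \<open>auto simp: add.commute\<close>)

lemma sum_h_UNIV:
  assumes z: "z \<in> G" shows "sum h UNIV = 2"
proof -
  have s0: "vec.subspace {0 :: 'a ^ 'n}" "{0} \<subseteq> z" 
    using generatorD(1)[OF z] by (auto simp: vec.subspace_single_0 vec.subspace_0)
  have "disjointness (ind Y + ind Z) $ z = (\<Sum>U\<in>{U\<in>G. U \<inter> z = {0}}. sum h U)"
    using z weights by (simp add: disjointness_def del: vector_add_component)
  also have "\<dots> = lam * sum h (UNIV - z)"
    using sum_weights_trace[OF z s0, of h] h_0 by (simp add: lam_def perp_def)
  also have "disjointness (ind Y + ind Z) = lam *\<^sub>R (2 *\<^sub>R ind G - (ind Y + ind Z))"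
    by (simp add: linear_add[OF linear_disjointness] disj_Y disj_Z scaleR_2 algebra_simps)
  also have "\<dots> $ z = lam * (2 - sum h z)" using z weights[OF z] by simp
  finally have "2 - sum h z = sum h (UNIV - z)" using lam_pos by simp
  then show ?thesis by (simp add: sum_diff)
qed

text \<open>
The two conditions on an extremal pair evaluated at the generators that meet \<open>y\<close> in \<open>J\<close>: the
difference through \<open>trace_mod_W\<close>, and the sum through the vector weights.
\<close>
lemma card_trace:
  assumes y: "y \<in> Y" "y \<notin> Z" and J: "vec.subspace J" "J \<subseteq> y"
  shows "real (card {U\<in>Y. U \<inter> y = J}) - real (card {U\<in>Z. U \<inter> y = J})
      = (-1) ^ (d - vec.dim J) * q ^ ((d - vec.dim J) choose 2)" (is ?diff)
    and "real (card {U\<in>Y. U \<inter> y = J}) + real (card {U\<in>Z. U \<inter> y = J})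
      = q ^ (Suc (d - vec.dim J) choose 2) * sum h J + q ^ ((d - vec.dim J) choose 2) * sum h (perp J - y)"
      (is ?sum)
proof -
  have yG: "y \<in> G" using y Y_G by auto
  note yD = generatorD[OF yG]
  have inn: "inner (ind A) (trace y J) = real (card {U\<in>A. U \<inter> y = J})" if "A \<subseteq> G" for A
  proof -
    have "A \<inter> {U\<in>G. U \<inter> y = J} = {U\<in>A. U \<inter> y = J}" using that by auto
    then show ?thesis by (simp add: inner_ind_ind)
  qed
  have "{U\<in>G. y \<subseteq> U} = {y}"
  proof -
    have "U = y" if "U \<in> G" "y \<subseteq> U" for U
      using that yD by (metis generatorD(1,2) vec.subspace_dim_equal order_refl)
    then show ?thesis using yG by auto
  qed
  then have py: "inner (ind A) (pencil y) = (if y \<in> A then 1 else 0)" for A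
    by (simp add: inner_ind)
  let ?m = "(-1) ^ (d - vec.dim J) * q ^ ((d - vec.dim J) choose 2)"
  have "trace y J - ?m *\<^sub>R pencil y \<in> W d" using trace_mod_W[OF yD(3) J] yD(2) by simp
  from balanced[OF this] show ?diff
    using y by (simp add: inner_diff_right inn[OF Y_G] inn[OF Z_G] py)
  have "(\<Sum>U\<in>{U\<in>G. U \<inter> y = J}. sum h U) = inner (ind Y + ind Z) (trace y J)"
    unfolding inner_ind using weights by (intro sum.cong) auto
  then show ?sum using sum_weights_trace[OF yG J, of h]
    by (simp add: inner_add_left inn[OF Y_G] inn[OF Z_G])
qed

lemma sum_h_eq_1: "y \<in> Y \<Longrightarrow> y \<notin> Z \<Longrightarrow> sum h y = 1"
  using weights[of y] Y_G by auto

text \<open>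
The left-hand side counts the members of \<open>Y\<close> and \<open>Z\<close>, with multiplicity, that meet \<open>y\<close> in the
hyperplane \<open>y \<inter> perp {x}\<close>. There is one more of \<open>Z\<close> than of \<open>Y\<close>, so it is at least \<open>1\<close>; and
its average over all \<open>x\<close> is \<open>1\<close> because the weights sum to \<open>2\<close> over the space and to \<open>1\<close> over \<open>y\<close>.
\<close>
lemma hyperplane_weight:
  assumes y: "y \<in> Y" "y \<notin> Z" and x: "x \<notin> y"
  shows "q * sum h (y \<inter> perp {x}) + sum h (perp (y \<inter> perp {x}) - y) = 1"
proof -
  have yG: "y \<in> G" using y Y_G by auto
  note yD = generatorD[OF yG]
  let ?t = "\<lambda>x. q * sum h (y \<inter> perp {x}) + sum h (perp (y \<inter> perp {x}) - y)"
  have ge: "?t x \<ge> 1" if x: "x \<notin> y" for x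
  proof -
    have s: "vec.subspace (y \<inter> perp {x})" by (intro vec.subspace_inter yD subspace_perp)
    have "d - vec.dim (y \<inter> perp {x}) = 1" using dim_Int_perp_point[OF yG x] by linarith
    then show ?thesis using card_trace[OF y s] by (simp add: numeral_2_eq_2)
  qed
  have s0: "vec.subspace {0 :: 'a ^ 'n}" "{0} \<subseteq> y" "{0} \<noteq> y"
    using yD d_pos by (auto simp: vec.subspace_single_0 vec.subspace_0)
  have p0: "perp {0 :: 'a ^ 'n} = UNIV" by (auto simp: perp_def)
  have sy: "sum h (y - {0}) = 1" using sum_h_eq_1[OF y] h_0 s0 by (simp add: sum_diff)
  have sV: "sum h (UNIV - y) = 1" using sum_h_UNIV[OF yG] sum_h_eq_1[OF y] by (simp add: sum_diff)
  have "(\<Sum>x\<in>UNIV - y. ?t x) = q * (q ^ (2 * d - 1) - q ^ d) + (q ^ Suc d - q ^ d)"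
    using sum_tangent_weights[OF yG s0, of h] by (simp only: p0) (simp add: h_0 sy sV)
  also have "\<dots> = q ^ (2 * d) - q ^ d"
  proof -
    have "q * q ^ (2 * d - 1) = q ^ (2 * d)" using d_pos by (simp flip: power_Suc)
    then show ?thesis by (simp add: algebra_simps)
  qed
  also have "\<dots> = real (card (UNIV - y))"
    using card_subspace_Diff[of UNIV y] yD(1,2) dim_V by (simp del: vec.dim_UNIV)
  finally have "(\<Sum>x\<in>UNIV - y. ?t x - 1) = 0" by (simp add: sum_subtractf)
  then have "\<forall>x\<in>UNIV - y. ?t x - 1 = 0"
    using ge by (subst (asm) sum_nonneg_eq_0_iff) auto
  then show ?thesis using x by simp
qed

lemma hyperplane_neighbours:
  assumes y: "y \<in> Y" "y \<notin> Z" and T: "vec.subspace T" "T \<subseteq> y" "Suc (vec.dim T) = d"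
  shows "{U\<in>Y. U \<inter> y = T} = {}" "\<exists>z\<in>Z - Y. z \<inter> y = T"
proof -
  have yG: "y \<in> G" using y Y_G by auto
  note yD = generatorD[OF yG]
  have "\<not> perp T \<subseteq> y" using vec.dim_subset[of "perp T" y] dim_perp[OF T(1)] T(3) yD(2) by auto
  then obtain x where x: "x \<in> perp T" "x \<notin> y" by auto
  have "T = y \<inter> perp {x}"
  proof (rule vec.subspace_dim_equal[OF T(1)])
    show "vec.subspace (y \<inter> perp {x})" by (intro vec.subspace_inter yD subspace_perp)
    show "T \<subseteq> y \<inter> perp {x}" using T(2) x by (auto simp: perp_def B_eq_0_commute[of x])
    show "vec.dim (y \<inter> perp {x}) \<le> vec.dim T" using dim_Int_perp_point[OF yG x(2)] T(3) by simp
  qed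
  with hyperplane_weight[OF y x(2)] have "q * sum h T + sum h (perp T - y) = 1" by simp
  moreover have "d - vec.dim T = 1" using T(3) by linarith
  ultimately have "real (card {U\<in>Y. U \<inter> y = T}) - real (card {U\<in>Z. U \<inter> y = T}) = -1"
    "real (card {U\<in>Y. U \<inter> y = T}) + real (card {U\<in>Z. U \<inter> y = T}) = 1"
    using card_trace[OF y T(1,2)] by (simp_all add: numeral_2_eq_2)
  then have 1: "real (card {U\<in>Y. U \<inter> y = T}) = 0" "real (card {U\<in>Z. U \<inter> y = T}) = 1" by linarith+
  then show e: "{U\<in>Y. U \<inter> y = T} = {}" by simp
  have "{U\<in>Z. U \<inter> y = T} \<noteq> {}" using 1(2) by (metis card.empty of_nat_0 zero_neq_one)
  then show "\<exists>z\<in>Z - Y. z \<inter> y = T" using e by blast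
qed

text \<open>
Averaging \<open>hyperplane_weight\<close> over the hyperplanes of \<open>y\<close> through \<open>R\<close> determines the weight of
\<open>perp R\<close> outside \<open>y\<close> from that of \<open>R\<close>. Consequently \<open>Y\<close> and \<open>Z\<close> together have \<open>q\<close> members meeting
\<open>y\<close> exactly in \<open>R\<close>. But \<open>Y\<close> has \<open>q\<close> more of them than \<open>Z\<close>, so none is in \<open>Z\<close>.
\<close>
lemma no_codimension_2:
  assumes y: "y \<in> Y" "y \<notin> Z" and R: "vec.subspace R" "R \<subseteq> y" "vec.dim R + 2 = d" and z: "z \<in> Z"
  shows "z \<inter> y \<noteq> R"
proof
  assume zR: "z \<inter> y = R"
  have yG: "y \<in> G" using y Y_G by auto
  note yD = generatorD[OF yG]
  have Ry: "R \<noteq> y" using R(3) yD(2) by auto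
  define r where "r = sum h R"
  define m where "m = sum h (perp R - y)"
  have yR: "y \<subseteq> perp R" using R(2) yD(4) perp_antimono[of R y] by auto
  have e: "2 * d - vec.dim R = d + 2" "2 * d - vec.dim R - 1 = d + 1" using R(3) by linarith+
  have "q ^ (d + 2) - q ^ d = real (card (perp R - y))"
    using card_subspace_Diff[OF subspace_perp yD(1) yR] yD(2) dim_perp[OF R(1)] R(3)
    by (metis (no_types, lifting) add_diff_cancel_right' e(1))
  also have "\<dots> = (\<Sum>x\<in>perp R - y. q * sum h (y \<inter> perp {x}) + sum h (perp (y \<inter> perp {x}) - y))"
    using hyperplane_weight[OF y] by simp
  also have "\<dots> = q * (r * (q ^ (d + 2) - q ^ d) + (1 - r) * (q ^ (d + 1) - q ^ d))
     + (q ^ (d + 1) - q ^ d) * m"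
    using sum_tangent_weights[OF yG R(1,2) Ry, of h] sum_h_eq_1[OF y] R(2)
    unfolding e by (simp add: r_def m_def sum_diff)
  finally have "(q ^ d * (q - 1)) * (q + 1) = (q ^ d * (q - 1)) * (q * (r * (q + 1) + (1 - r)) + m)"
    by (simp add: algebra_simps power2_eq_square)
  moreover have "q ^ d * (q - 1) \<noteq> 0" using q_gt_1 by simp
  ultimately have "q + 1 = q * (r * (q + 1) + (1 - r)) + m" by (metis mult_left_cancel)
  then have m: "m = 1 - q\<^sup>2 * r" by (simp add: algebra_simps power2_eq_square)
  have "d - vec.dim R = 2" using R(3) by linarith
  moreover have "(3::nat) choose 2 = 3" by (simp add: numeral_3_eq_3 numeral_2_eq_2)
  ultimately have "real (card {U\<in>Y. U \<inter> y = R}) - real (card {U\<in>Z. U \<inter> y = R}) = q"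
    "real (card {U\<in>Y. U \<inter> y = R}) + real (card {U\<in>Z. U \<inter> y = R}) = q ^ 3 * r + q * m"
    using card_trace[OF y R(1,2)] by (simp_all add: r_def m_def)
  moreover have "q ^ 3 * r + q * m = q" unfolding m by (simp add: algebra_simps power2_eq_square power3_eq_cube)
  ultimately have "real (card {U\<in>Z. U \<inter> y = R}) = 0" by linarith
  then have "{U\<in>Z. U \<inter> y = R} = {}" by simp
  with z zR show False by auto
qed

section \<open>Three generators met by three generators\<close>

lemma common_point_outside:
  assumes y: "y \<in> Y" "y \<notin> Z" and z: "z \<in> Z" and R: "vec.subspace R" "R \<subseteq> y" "R \<subseteq> z" "vec.dim R + 2 = d"
  obtains c where "c \<in> y" "c \<in> z" "c \<notin> R"
  using no_codimension_2[OF y R(1,2,4) z] R(2,3) by blast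

lemma Int_eq_of_codimension_2:
  assumes y: "y \<in> Y" "y \<notin> Z" and y': "y' \<in> Y" "y' \<noteq> y"
    and R: "vec.subspace R" "R \<subseteq> y" "R \<subseteq> y'" "vec.dim R + 2 = d"
  shows "y' \<inter> y = R"
proof -
  have yG: "y \<in> G" "y' \<in> G" using y y' Y_G by auto
  note yD = generatorD[OF yG(1)] and yD' = generatorD[OF yG(2)]
  have s: "vec.subspace (y' \<inter> y)" by (intro vec.subspace_inter yD yD')
  have "Suc (vec.dim (y' \<inter> y)) \<noteq> d" using hyperplane_neighbours(1)[OF y s] y' by auto
  moreover have "vec.dim (y' \<inter> y) \<noteq> d"
  proof
    assume d: "vec.dim (y' \<inter> y) = d"
    have "y' \<inter> y = y" by (rule vec.subspace_dim_equal[OF s yD(1)]) (use d yD(2) in auto)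
    moreover have "y' \<inter> y = y'" by (rule vec.subspace_dim_equal[OF s yD'(1)]) (use d yD'(2) in auto)
    ultimately show False using y' by simp
  qed
  moreover have "vec.dim (y' \<inter> y) \<le> d" using vec.dim_subset[of "y' \<inter> y" y] yD(2) by simp
  ultimately have "vec.dim (y' \<inter> y) \<le> vec.dim R" using R(4) by linarith
  then show ?thesis using R s by (intro vec.subspace_dim_equal[symmetric]) auto
qed

text \<open>
Modulo \<open>R\<close> the generators become lines of a symplectic space of dimension four, and \<open>z\<close> is a line
meeting the three pairwise disjoint lines \<open>y1\<close>, \<open>y2\<close>, \<open>y3\<close>. As \<open>y3\<close> is the graph of an isomorphism
from \<open>y1\<close> to \<open>y2\<close>, the line \<open>z\<close> joins \<open>v\<close> to its image, here represented by \<open>c\<close>.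
\<close>
lemma transversal_partner:
  assumes R: "vec.subspace R" "vec.dim R + 2 = d"
    and y: "y1 \<in> Y" "y2 \<in> Y" "y2 \<notin> Z" "y3 \<in> Y" "y3 \<notin> Z" 
    and i: "y1 \<inter> y2 = R" "y2 \<inter> y3 = R" 
    and z: "z \<in> Z" "z \<inter> y1 = adjoin v R" and v: "v \<notin> R"
  obtains c where "c \<in> y2" "v + c \<in> y3" "B v c = 0"
proof -
  have vz: "v \<in> z" "R \<subseteq> z" "v \<in> y1" using z(2) adjoin_superset[where J = R and v = v] by auto
  obtain c where c: "c \<in> y2" "c \<in> z" "c \<notin> R"
    using common_point_outside[OF y(2,3) z(1) R(1) _ vz(2) R(2)] i by auto
  obtain g where g: "g \<in> y3" "g \<in> z" "g \<notin> R"
    using common_point_outside[OF y(4,5) z(1) R(1) _ vz(2) R(2)] i by auto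
  have zG: "z \<in> G" using z Z_G by auto
  note zD = generatorD[OF zG]
  have sy: "vec.subspace y2" "vec.subspace y3" using y Y_G generatorD by auto
  have cn: "c \<notin> adjoin v R" using c i z(2) by auto
  have "vec.dim (adjoin c (adjoin v R)) = d"
    unfolding dim_adjoin[OF vec.subspace_span cn] dim_adjoin[OF R(1) v] using R(2) by simp
  moreover have "adjoin v R \<subseteq> z" using z(2) by blast
  then have "adjoin c (adjoin v R) \<subseteq> z" using c(2) by (intro vec.span_minimal zD(1)) simp
  ultimately have "adjoin c (adjoin v R) = z" using zD(1,2) by (intro vec.subspace_dim_equal) auto
  then have "g \<in> adjoin c (adjoin v R)" using g(2) by blast
  then obtain k a where ka: "a \<in> adjoin v R" "g = k *s c + a" using adjoinE[OF vec.subspace_span] by blast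
  obtain l r where lr: "r \<in> R" "a = l *s v + r" using ka(1) adjoinE[OF R(1)] by blast
  have kr: "k *s c + r \<in> y2" using c lr i sy by (auto intro!: vec.subspace_add vec.subspace_scale)
  have l: "l \<noteq> 0"
  proof
    assume "l = 0"
    then have "g \<in> y2" using ka lr kr by simp
    then show False using g i by auto
  qed
  let ?c = "inverse l *s (k *s c + r)"
  have "v + ?c = inverse l *s g" using ka lr l
    by (simp add: vec.scale_right_distrib vec.scale_scale add_ac)
  moreover have "inverse l *s g \<in> y3" by (rule vec.subspace_scale[OF sy(2) g(1)])
  moreover have "?c \<in> y2" by (rule vec.subspace_scale[OF sy(1) kr])
  moreover have "B v ?c = 0"
  proof -
    have "B v c = 0" "B v r = 0" using zD(3) c(2) vz lr(1) by (auto simp: totally_isotropic_def)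
    then show ?thesis by simp
  qed
  ultimately show ?thesis using that by metis
qed

text \<open>
Take \<open>y1\<close> in \<open>Y\<close> but not in \<open>Z\<close> and \<open>R\<close> of codimension two in it. Neighbours of \<open>y1\<close> in \<open>Z\<close>
through \<open>R\<close>, and then neighbours of one of them in \<open>Y\<close>, yield three members of \<open>Y\<close> that meet pairwise
in \<open>R\<close> and three members of \<open>Z\<close> meeting each of them in more than \<open>R\<close>. Let \<open>\<phi>\<close> be the isomorphism
from \<open>y1\<close> to \<open>y2\<close> modulo \<open>R\<close> whose graph is \<open>y3\<close>. The form \<open>B x (\<phi> y)\<close> on \<open>y1\<close> is symmetric because \<open>y3\<close>
is totally isotropic, and it vanishes on the diagonal at \<open>a\<close>, \<open>b\<close> and \<open>a + b\<close>. In odd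
characteristic it is therefore zero, which puts \<open>\<phi> a\<close> into \<open>perp y1 = y1\<close>.
\<close>
lemma Y_subset_Z:
  assumes odd: "(1 :: 'a) + 1 \<noteq> 0" and d2: "d \<ge> 2"
  shows "Y \<subseteq> Z"
proof (rule ccontr)
  assume "\<not> Y \<subseteq> Z"
  then obtain y1 where y1: "y1 \<in> Y" "y1 \<notin> Z" by auto
  interpret swap: extremal_pair B d q Z Y h by (rule extremal_pair_swap)
  have yG: "y1 \<in> G" using y1 Y_G by auto
  note yD = generatorD[OF yG]
  have s0: "vec.subspace {0 :: 'a ^ 'n}" by (rule vec.subspace_single_0)
  obtain L where L: "vec.subspace L" "L \<subseteq> y1" "d = Suc (vec.dim L)"
  proof -
    have "{0} \<noteq> y1" using yD(2) d2 by auto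
    then show ?thesis using hyperplane_exists[OF s0 yD(1)] vec.subspace_0[OF yD(1)] yD(2) that by auto
  qed
  obtain R where R: "vec.subspace R" "R \<subseteq> L" "vec.dim L = Suc (vec.dim R)"
  proof -
    have "{0} \<noteq> L" using L(3) d2 by auto
    then show ?thesis using hyperplane_exists[OF s0 L(1)] vec.subspace_0[OF L(1)] that by auto
  qed
  have dR: "vec.dim R + 2 = d" using L R by simp
  obtain a where a: "a \<in> L" "a \<notin> R" using R L by (metis n_not_Suc_n subset_antisym subsetI)
  obtain b where b: "b \<in> y1" "b \<notin> L" using L yD(2) by (metis n_not_Suc_n subset_antisym subsetI)
  have ab: "a + b \<in> y1" "a + b \<notin> R" "b \<notin> R" "a \<in> y1"
  proof -
    show "a \<in> y1" "b \<notin> R" using a b L R by auto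
    then show "a + b \<in> y1" using b by (intro vec.subspace_add yD)
    show "a + b \<notin> R"
    proof
      assume "a + b \<in> R"
      then have "(a + b) - a \<in> L" using a R by (intro vec.subspace_diff L) auto
      then show False using b by simp
    qed
  qed
  have Ry1: "R \<subseteq> y1" using L R by auto
  have nb: "\<exists>z\<in>Z - Y. z \<inter> y1 = adjoin v R" if "v \<in> y1" "v \<notin> R" for v
    using that Ry1 dim_adjoin[OF R(1), of v] dR yD(1)
    by (intro hyperplane_neighbours(2)[OF y1]) (auto simp: vec.span_minimal)
  \<comment> \<open>Modulo \<open>R\<close> the vectors \<open>a\<close>, \<open>b\<close>, \<open>a + b\<close> span three different points of the line \<open>y1\<close>.\<close>
  obtain z1 where z1: "z1 \<in> Z" "z1 \<notin> Y" "z1 \<inter> y1 = adjoin a R" using nb[of a] ab a by auto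
  obtain z2 where z2: "z2 \<in> Z" "z2 \<inter> y1 = adjoin b R" using nb[of b] ab b by auto
  obtain z3 where z3: "z3 \<in> Z" "z3 \<inter> y1 = adjoin (a + b) R" using nb[of "a + b"] ab by auto
  have z1G: "z1 \<in> G" using z1 Z_G by auto
  note zD = generatorD[OF z1G]
  have az: "a \<in> z1" "R \<subseteq> z1" using z1(3) adjoin_superset[where J = R and v = a] by auto
  have "\<not> z1 \<subseteq> y1"
  proof
    assume "z1 \<subseteq> y1"
    then have "z1 = y1" using zD yD by (intro vec.subspace_dim_equal) auto
    then show False using y1 z1 by simp
  qed
  \<comment> \<open>The points \<open>e\<close> and \<open>e + a\<close> of \<open>z1\<close> modulo \<open>R\<close> both differ from the point \<open>a\<close> on \<open>y1\<close>.\<close>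
  then obtain e where e: "e \<in> z1" "e \<notin> y1" by auto
  have eR: "e \<notin> R" using e Ry1 by auto
  have ea: "e + a \<in> z1" "e + a \<notin> R" "e + a \<notin> y1"
  proof -
    show "e + a \<in> z1" using e az by (intro vec.subspace_add zD)
    show "e + a \<notin> y1"
    proof
      assume "e + a \<in> y1"
      then have "(e + a) - a \<in> y1" using ab by (intro vec.subspace_diff yD)
      then show False using e by simp
    qed
    then show "e + a \<notin> R" using Ry1 by auto
  qed
  have nb': "\<exists>y\<in>Y - Z. y \<inter> z1 = adjoin v R" if "v \<in> z1" "v \<notin> R" for v
    using that az(2) dim_adjoin[OF R(1), of v] dR zD(1)
    by (intro swap.hyperplane_neighbours(2)[OF z1(1,2)]) (auto simp: vec.span_minimal)
  obtain y2 where y2: "y2 \<in> Y" "y2 \<notin> Z" "y2 \<inter> z1 = adjoin e R" using nb'[OF e(1) eR] by auto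
  obtain y3 where y3: "y3 \<in> Y" "y3 \<notin> Z" "y3 \<inter> z1 = adjoin (e + a) R" using nb'[OF ea(1,2)] by auto
  have in2: "R \<subseteq> y2" "e \<in> y2" using y2(3) adjoin_superset[where J = R and v = e] by auto
  have in3: "R \<subseteq> y3" "e + a \<in> y3" using y3(3) adjoin_superset[where J = R and v = "e + a"] by auto
  have i12: "y1 \<inter> y2 = R"
    using Int_eq_of_codimension_2[OF y1 y2(1) _ R(1) Ry1 in2(1) dR] in2 e by (auto simp: Int_commute)
  have i13: "y1 \<inter> y3 = R"
    using Int_eq_of_codimension_2[OF y1 y3(1) _ R(1) Ry1 in3(1) dR] in3 ea by (auto simp: Int_commute)
  have sy2: "vec.subspace y2" and sy3: "vec.subspace y3" and ti2: "totally_isotropic B y2" and ti3: "totally_isotropic B y3"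
    using y2 y3 Y_G generatorD by auto
  have "y3 \<noteq> y2"
  proof
    assume "y3 = y2"
    then have "(e + a) - e \<in> y2" using in2 in3 by (intro vec.subspace_diff sy2) auto
    then have "a \<in> R" using i12 ab by auto
    then show False using a by simp
  qed
  then have i23: "y2 \<inter> y3 = R"
    using Int_eq_of_codimension_2[OF y2(1,2) y3(1) _ R(1) in2(1) in3(1) dR] by (auto simp: Int_commute)
  note partner = transversal_partner[OF R(1) dR y1(1) y2(1,2) y3(1,2) i12 i23]
  obtain c1 where c1: "c1 \<in> y2" "a + c1 \<in> y3" "B a c1 = 0" using partner[OF z1(1,3) a(2)] by metis
  obtain c2 where c2: "c2 \<in> y2" "b + c2 \<in> y3" "B b c2 = 0" using partner[OF z2 ab(3)] by metis
  obtain c3 where c3: "c3 \<in> y2" "a + b + c3 \<in> y3" "B (a + b) c3 = 0" using partner[OF z3 ab(2)] by metis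
  \<comment> \<open>The partners are additive modulo \<open>R\<close>, since \<open>y2\<close> and \<open>y3\<close> share only \<open>R\<close>.\<close>
  define r where "r = c1 + c2 - c3"
  have "r \<in> y2" unfolding r_def using c1 c2 c3 by (intro vec.subspace_diff vec.subspace_add sy2)
  moreover have "r \<in> y3"
  proof -
    have "(a + c1) + (b + c2) - (a + b + c3) \<in> y3"
      by (rule vec.subspace_diff[OF sy3 vec.subspace_add[OF sy3 c1(2) c2(2)] c3(2)])
    then show ?thesis by (simp add: r_def algebra_simps)
  qed
  ultimately have rR: "r \<in> R" using i23 by auto
  have ti1: "B u v = 0" if "u \<in> y1" "v \<in> y1" for u v using yD(3) that by (auto simp: totally_isotropic_def)
  have "B (a + b) r = 0" using ti1[OF ab(1)] rR Ry1 by auto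
  then have 1: "B a c2 + B b c1 = 0" using c1(3) c2(3) c3(3) by (simp add: r_def add.commute)
  \<comment> \<open>Symmetry of the form; with the previous relation it gives twice \<open>B b c1\<close> equal to zero.\<close>
  have "B (a + c1) (b + c2) = 0" using ti3 c1(2) c2(2) unfolding totally_isotropic_def by blast
  moreover have "B c1 c2 = 0" using ti2 c1 c2 by (auto simp: totally_isotropic_def)
  ultimately have "B a c2 + B c1 b = 0" using ti1[OF ab(4) b(1)] by (simp add: add.commute)
  then have 2: "B a c2 = B b c1" using B_skew[of c1 b] by simp
  have "(1 + 1) * B b c1 = 0" using 1 2 by (simp add: distrib_right)
  then have bc: "B b c1 = 0" using odd by simp
  have "c1 \<in> perp (insert b (insert a R))"
    using bc c1 ti2 in2(1) by (auto simp: perp_def totally_isotropic_def)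
  moreover have "perp (insert b (insert a R)) = perp y1"
  proof -
    have LR: "adjoin a R = L" using a R L dim_adjoin[OF R(1) a(2)]
      by (intro vec.subspace_dim_equal) (auto simp: vec.span_minimal)
    have "adjoin b L = y1" using b L yD dim_adjoin[OF L(1) b(2)]
      by (intro vec.subspace_dim_equal) (auto simp: vec.span_minimal)
    then have "perp y1 = perp (insert b L)" using perp_span by metis
    also have "\<dots> = perp L \<inter> perp {b}" by (rule perp_insert)
    also have "perp L = perp (insert a R)" using LR perp_span by metis
    also have "\<dots> \<inter> perp {b} = perp (insert b (insert a R))" by (rule perp_insert[symmetric])
    finally show ?thesis by simp
  qed
  ultimately have "c1 \<in> y1" using yD(4) by simp
  then have "c1 \<in> R" using i12 c1 by auto
  then have "(a + c1) - c1 \<in> y3" using c1 in3 by (intro vec.subspace_diff sy3) auto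
  then have "a \<in> R" using i13 ab by auto
  then show False using a by simp
qed

end

text \<open>
Translation by \<open>1\<close> permutes the field, so the sum of all elements does not change when \<open>1\<close> is added
to each: the size of the field is zero in the field.
\<close>
lemma odd_card_field_two_ne_0:
  assumes "odd CARD('a::{field,finite})" shows "(1 :: 'a) + 1 \<noteq> 0"
proof
  assume 2: "(1 :: 'a) + 1 = 0"
  have "(\<Sum>x\<in>UNIV. x :: 'a) = (\<Sum>x\<in>UNIV. x + 1)"
    by (rule sum.reindex_bij_witness[of _ "\<lambda>x. x + 1" "\<lambda>x. x - 1"]) auto
  then have 0: "of_nat CARD('a) = (0 :: 'a)" by (simp add: sum.distrib)
  obtain m where "CARD('a) = 2 * m + 1" using assms oddE by blast
  then have "of_nat CARD('a) = (1 + 1) * of_nat m + (1 :: 'a)" by (simp add: algebra_simps)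
  then show False using 0 2 by simp
qed

section \<open>Maximum cross-intersecting pairs\<close>

theorem theorem5p16:
  fixes B :: "'a::{field,finite} ^ 'n \<Rightarrow> 'a ^ 'n \<Rightarrow> 'a"
    and Y Z :: "('a ^ 'n) set set"
    and d q :: nat
  assumes "CARD('a) = q"
    and "CARD('n) = 2 * d"
    and "symplectic_form B"
    and "even d"
    and "odd q"
    and "maximum_cross_intersecting_EKR d B Y Z"
  shows "Y = Z"
proof -
  interpret symplectic_space B d "real q"
    using assms by unfold_locales auto
  show ?thesis
  proof (cases "generators d B = {}")
    case True
    then show ?thesis
      using assms(6) by (auto simp: maximum_cross_intersecting_EKR_def cross_intersecting_EKR_def)
  next
    case False
    obtain h where "extremal_pair B d (real q) Y Z h"
      using maximum_extremal_pair[OF assms(6) False assms(4)] by metis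
    then interpret extremal_pair B d "real q" Y Z h .
    interpret swap: extremal_pair B d "real q" Z Y h by (rule extremal_pair_swap)
    have "(1 :: 'a) + 1 \<noteq> 0" using odd_card_field_two_ne_0 assms(1,5) by blast
    moreover have "d \<ge> 2" using d_pos assms(4) by (cases "d = 1") auto
    ultimately show ?thesis using Y_subset_Z swap.Y_subset_Z by blast
  qed
qed

end
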